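(* Let $\pi:(M,\varphi,\xi,\eta,g)\to(M',J,g')$ be a contact-complex Riemannian submersion with $\dim M=2m+1\ge5$ and $\dim M'=2n\ge4$. Let $\omega$ be the Lee form of $M$ and $\beta$ the Lee form of $M'$, and assume $d\phi=-2\omega\wedge\phi$. Then \[\beta(\pi_*(X))=\omega(X)\] for every basic vector field $X$ on $M$ (i.e. $\beta(X')\circ\pi=\omega(X)$ when $X$ is horizontal and $\pi$-related to $X'\in\chi(M')$). Moreover, $(M',J,g')$ is in the Gray-Hervella class $W_2\oplus W_4$.
   Context: All objects are smooth. An almost contact metric (ACM) manifold $(M,\varphi,\xi,\eta,g)$ is a $(2m+1)$-dimensional Riemannian manifold with a $(1,1)$-tensor field $\varphi$, a vector field $\xi$ and a 1-form $\eta$ such that $\varphi^2=-I+\eta\otimes\xi$, $\eta(\xi)=1$, $g(\varphi X,\varphi Y)=g(X,Y)-\eta(X)\eta(Y)$. Its fundamental form is $\phi(X,Y)=g(X,\varphi Y)$. $\nabla$ is the Levi-Civita connection and $\delta$ the codifferential: for a local orthonormal frame $\{e_i\}$, $\delta\eta=-\sum_i(\nabla_{e_i}\eta)(e_i)$ and $\delta\phi(X)=-\sum_i(\nabla_{e_i}\phi)(e_i,X)$. For $m\ge2$ the Lee form of $M$ is \[\omega=-\tfrac{1}{2(m-1)}\big(\delta\phi\circ\varphi+\nabla_\xi\eta\big)+\tfrac{\delta\eta}{2m}\,\eta .\] An almost Hermitian manifold $(M',J,g')$ ($J^2=-I$, $g'(J\cdot,J\cdot)=g'$) of dimension $2n$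 has fundamental form $\Omega(X,Y)=g'(X,JY)$ and, for $n\ge2$, Lee form $\beta=-\frac{1}{2(n-1)}\delta\Omega\circ J$. For $2n\geq 4$, $M'$ is in the Gray-Hervella class $W_2\oplus W_4$ iff there is a 1-form $\theta$ with $d\Omega=-2\theta\wedge\Omega$, and then $\theta=\beta$ (in dimension $4$ this holds automatically). A contact-complex Riemannian submersion $\pi:(M,\varphi,\xi,\eta,g)\to(M',J,g')$ is a Riemannian submersion from an ACM manifold onto an almost Hermitian manifold with $J\circ\pi_*=\pi_*\circ\varphi$. A basic vector field on $M$ is a horizontal vector field $X$ (orthogonal to $\ker\pi_*$) that is $\pi$-related to a vector field $X'=\pi_*X$ on $M'$. *)

theory Defs
  imports "HOL-Analysis.Analysis"
begin

section \<open>Smooth functions between Euclidean spaces\<close>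

text \<open>Only used for open \<open>S\<close>. In finite dimension, iterated directional
  derivatives give the usual notion of class \<open>C\<^sup>k\<close>.\<close>

primrec Ck_on ::
  "nat \<Rightarrow> 'e::euclidean_space set \<Rightarrow> ('e \<Rightarrow> 'b::real_normed_vector) \<Rightarrow> bool" where
  "Ck_on 0 S f \<longleftrightarrow> continuous_on S f"
| "Ck_on (Suc k) S f \<longleftrightarrow>
     (\<forall>x\<in>S. f differentiable (at x)) \<and>
     (\<forall>v. Ck_on k S (\<lambda>x. frechet_derivative f (at x) v))"

definition smooth_on :: "'e::euclidean_space set \<Rightarrow> ('e \<Rightarrow> 'b::real_normed_vector) \<Rightarrow> bool" where
  "smooth_on S f \<longleftrightarrow> (\<forall>k. Ck_on k S f)"


section \<open>Smooth manifolds\<close>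

text \<open>The manifold is the whole type \<open>'a\<close>, with the topology of its type class; its
  dimension is that of the model space \<open>'e\<close>. A chart is a domain together with a coordinate
  map, whose values outside the domain are irrelevant.\<close>

type_synonym ('a, 'e) chart = "'a set \<times> ('a \<Rightarrow> 'e)"
type_synonym ('a, 'e) atlas = "('a, 'e) chart set"

definition chart_inv :: "('a, 'e) chart \<Rightarrow> 'e \<Rightarrow> 'a" where
  "chart_inv c = inv_into (fst c) (snd c)"

definition smooth_manifold ::
  "('a::{t2_space,second_countable_topology}, 'e::euclidean_space) atlas \<Rightarrow> bool" where
  "smooth_manifold A \<longleftrightarrow>
     (\<Union>c\<in>A. fst c) = UNIV \<and>
     (\<forall>c\<in>A. open (fst c) \<and> open (snd c ` fst c) \<and>
             homeomorphism (fst c) (snd c ` fst c) (snd c) (chart_inv c)) \<and>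
     (\<forall>c\<in>A. \<forall>d\<in>A. smooth_on (snd c ` (fst c \<inter> fst d)) (snd d \<circ> chart_inv c))"

definition msmooth_on ::
  "('a, 'e::euclidean_space) atlas \<Rightarrow> 'a set \<Rightarrow> ('a \<Rightarrow> 'b::real_normed_vector) \<Rightarrow> bool" where
  "msmooth_on A U f \<longleftrightarrow> (\<forall>c\<in>A. smooth_on (snd c ` (fst c \<inter> U)) (f \<circ> chart_inv c))"

definition smooth_map ::
  "('a::topological_space, 'e::euclidean_space) atlas \<Rightarrow>
   ('b::topological_space, 'f::euclidean_space) atlas \<Rightarrow> ('a \<Rightarrow> 'b) \<Rightarrow> bool" where
  "smooth_map A B h \<longleftrightarrow>
     continuous_on UNIV h \<and> (\<forall>d\<in>B. msmooth_on A (h -` fst d) (snd d \<circ> h))"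


section \<open>Tangent vectors and vector fields\<close>

text \<open>A preferred chart \<open>chart_at A p\<close> is chosen around every point \<open>p\<close>, and a tangent
  vector at \<open>p\<close> is given by its component vector in that chart. Thus every tangent space is
  a copy of \<open>'e\<close>, but components at different points may refer to different charts, so that
  the smoothness of a vector field is not the smoothness of the function \<open>'a \<Rightarrow> 'e\<close>
  representing it.\<close>

definition chart_at :: "('a, 'e) atlas \<Rightarrow> 'a \<Rightarrow> ('a, 'e) chart" where
  "chart_at A p = (SOME c. c \<in> A \<and> p \<in> fst c)"

text \<open>\<open>mderiv A f p v\<close> is the derivative \<open>v(f) = df\<^sub>p(v)\<close> of a vector-valued function
  along the tangent vector \<open>v\<close> at \<open>p\<close>.\<close>

definition mderiv ::
  "('a, 'e::euclidean_space) atlas \<Rightarrow> ('a \<Rightarrow> 'b::real_normed_vector) \<Rightarrow> 'a \<Rightarrow> 'e \<Rightarrow> 'b" where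
  "mderiv A f p v =
     frechet_derivative (f \<circ> chart_inv (chart_at A p)) (at (snd (chart_at A p) p)) v"

definition tangent_map ::
  "('a, 'e::euclidean_space) atlas \<Rightarrow> ('b, 'f::euclidean_space) atlas \<Rightarrow> ('a \<Rightarrow> 'b) \<Rightarrow>
   'a \<Rightarrow> 'e \<Rightarrow> 'f" where
  "tangent_map A B h p = mderiv A (snd (chart_at B (h p)) \<circ> h) p"

type_synonym ('a, 'e) vfield = "'a \<Rightarrow> 'e"

text \<open>For a chart \<open>c\<close>, the vector \<open>mderiv A (snd c) p (X p)\<close> consists of the components
  of \<open>X\<close> at \<open>p\<close> in the chart \<open>c\<close>.\<close>

definition smooth_vf ::
  "('a::topological_space, 'e::euclidean_space) atlas \<Rightarrow> 'a set \<Rightarrow> ('a, 'e) vfield \<Rightarrow> bool" where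
  "smooth_vf A U X \<longleftrightarrow>
     (\<forall>c\<in>A. msmooth_on A (fst c \<inter> U) (\<lambda>p. mderiv A (snd c) p (X p)))"

text \<open>The components of \<open>[X, Y]\<close> at \<open>p\<close> are \<open>X(Y(x\<^sup>i)) - Y(X(x\<^sup>i))\<close>, where \<open>x\<^sup>i\<close> are the
  coordinates of the preferred chart at \<open>p\<close>.\<close>

definition lie_bracket ::
  "('a, 'e::euclidean_space) atlas \<Rightarrow> ('a, 'e) vfield \<Rightarrow> ('a, 'e) vfield \<Rightarrow> ('a, 'e) vfield" where
  "lie_bracket A X Y p =
     mderiv A (\<lambda>q. mderiv A (snd (chart_at A p)) q (Y q)) p (X p) -
     mderiv A (\<lambda>q. mderiv A (snd (chart_at A p)) q (X q)) p (Y p)"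


section \<open>Tensor fields and differential forms\<close>

text \<open>A tensor field is smooth if it sends local smooth vector fields to smooth functions
  or smooth vector fields.\<close>

type_synonym ('a, 'e) form1 = "'a \<Rightarrow> 'e \<Rightarrow> real"
type_synonym ('a, 'e) form2 = "'a \<Rightarrow> 'e \<Rightarrow> 'e \<Rightarrow> real"
type_synonym ('a, 'e) endo = "'a \<Rightarrow> 'e \<Rightarrow> 'e"

definition one_form ::
  "('a::topological_space, 'e::euclidean_space) atlas \<Rightarrow> ('a, 'e) form1 \<Rightarrow> bool" where
  "one_form A \<alpha> \<longleftrightarrow>
     (\<forall>p. linear (\<alpha> p)) \<and>
     (\<forall>U X. open U \<longrightarrow> smooth_vf A U X \<longrightarrow> msmooth_on A U (\<lambda>p. \<alpha> p (X p)))"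

definition endo_field ::
  "('a::topological_space, 'e::euclidean_space) atlas \<Rightarrow> ('a, 'e) endo \<Rightarrow> bool" where
  "endo_field A F \<longleftrightarrow>
     (\<forall>p. linear (F p)) \<and>
     (\<forall>U X. open U \<longrightarrow> smooth_vf A U X \<longrightarrow> smooth_vf A U (\<lambda>p. F p (X p)))"

definition riemannian_metric ::
  "('a::topological_space, 'e::euclidean_space) atlas \<Rightarrow> ('a, 'e) form2 \<Rightarrow> bool" where
  "riemannian_metric A g \<longleftrightarrow>
     (\<forall>p. bilinear (g p)) \<and>
     (\<forall>p u v. g p u v = g p v u) \<and>
     (\<forall>p u. u \<noteq> 0 \<longrightarrow> g p u u > 0) \<and>
     (\<forall>U X Y. open U \<longrightarrow> smooth_vf A U X \<longrightarrow> smooth_vf A U Y \<longrightarrow>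
        msmooth_on A U (\<lambda>p. g p (X p) (Y p)))"

text \<open>Exterior derivative of a 2-form and wedge product of a 1-form and a 2-form, both
  without the factor \<open>1/3\<close> that some authors put in front of each of them. Equations of
  the form \<open>dF = c (\<alpha> \<and> F)\<close> are the same in both conventions.\<close>

definition ext_deriv2 ::
  "('a, 'e::euclidean_space) atlas \<Rightarrow> ('a, 'e) form2 \<Rightarrow>
   ('a, 'e) vfield \<Rightarrow> ('a, 'e) vfield \<Rightarrow> ('a, 'e) vfield \<Rightarrow> 'a \<Rightarrow> real" where
  "ext_deriv2 A F X Y Z p =
     mderiv A (\<lambda>q. F q (Y q) (Z q)) p (X p)
     - mderiv A (\<lambda>q. F q (X q) (Z q)) p (Y p)
     + mderiv A (\<lambda>q. F q (X q) (Y q)) p (Z p)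
     - F p (lie_bracket A X Y p) (Z p)
     + F p (lie_bracket A X Z p) (Y p)
     - F p (lie_bracket A Y Z p) (X p)"

definition wedge12 ::
  "('a, 'e) form1 \<Rightarrow> ('a, 'e) form2 \<Rightarrow> 'a \<Rightarrow> 'e \<Rightarrow> 'e \<Rightarrow> 'e \<Rightarrow> real" where
  "wedge12 \<alpha> F p u v w = \<alpha> p u * F p v w + \<alpha> p v * F p w u + \<alpha> p w * F p u v"

definition lee_equation ::
  "('a::topological_space, 'e::euclidean_space) atlas \<Rightarrow>
   ('a, 'e) form1 \<Rightarrow> ('a, 'e) form2 \<Rightarrow> bool" where
  "lee_equation A \<alpha> F \<longleftrightarrow>
     (\<forall>U X Y Z. open U \<longrightarrow> smooth_vf A U X \<longrightarrow> smooth_vf A U Y \<longrightarrow> smooth_vf A U Z \<longrightarrow>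
        (\<forall>p\<in>U. ext_deriv2 A F X Y Z p = - 2 * wedge12 \<alpha> F p (X p) (Y p) (Z p)))"


section \<open>Connections and codifferentials\<close>

text \<open>Connections are applied to local vector fields as well: the laws are required for
  fields that are smooth on an arbitrary open set \<open>U\<close>, at the points of \<open>U\<close>. Taking for \<open>f\<close>
  the indicator function of \<open>- U\<close> in the Leibniz and linearity laws shows that
  \<open>\<nabla>\<^sub>X Y\<close> at \<open>p\<close> depends only on the germs of \<open>X\<close> and \<open>Y\<close> at \<open>p\<close>.\<close>

type_synonym ('a, 'e) conn = "('a, 'e) vfield \<Rightarrow> ('a, 'e) vfield \<Rightarrow> ('a, 'e) vfield"

definition connection ::
  "('a::topological_space, 'e::euclidean_space) atlas \<Rightarrow> ('a, 'e) conn \<Rightarrow> bool" where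
  "connection A D \<longleftrightarrow>
     (\<forall>U X Y. open U \<longrightarrow> smooth_vf A U X \<longrightarrow> smooth_vf A U Y \<longrightarrow> smooth_vf A U (D X Y)) \<and>
     (\<forall>U X Y Z. open U \<longrightarrow> smooth_vf A U X \<longrightarrow> smooth_vf A U Y \<longrightarrow> smooth_vf A U Z \<longrightarrow>
        (\<forall>p\<in>U. D (\<lambda>q. X q + Y q) Z p = D X Z p + D Y Z p \<and>
                D X (\<lambda>q. Y q + Z q) p = D X Y p + D X Z p)) \<and>
     (\<forall>U X Y f. open U \<longrightarrow> smooth_vf A U X \<longrightarrow> smooth_vf A U Y \<longrightarrow> msmooth_on A U f \<longrightarrow>
        (\<forall>p\<in>U. D (\<lambda>q. f q *\<^sub>R X q) Y p = f p *\<^sub>R D X Y p \<and>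
                D X (\<lambda>q. f q *\<^sub>R Y q) p = mderiv A f p (X p) *\<^sub>R Y p + f p *\<^sub>R D X Y p))"

definition levi_civita ::
  "('a::topological_space, 'e::euclidean_space) atlas \<Rightarrow> ('a, 'e) form2 \<Rightarrow> ('a, 'e) conn \<Rightarrow> bool"
  where
  "levi_civita A g D \<longleftrightarrow>
     connection A D \<and>
     (\<forall>U X Y. open U \<longrightarrow> smooth_vf A U X \<longrightarrow> smooth_vf A U Y \<longrightarrow>
        (\<forall>p\<in>U. D X Y p - D Y X p = lie_bracket A X Y p)) \<and>
     (\<forall>U X Y Z. open U \<longrightarrow> smooth_vf A U X \<longrightarrow> smooth_vf A U Y \<longrightarrow> smooth_vf A U Z \<longrightarrow>
        (\<forall>p\<in>U. mderiv A (\<lambda>q. g q (Y q) (Z q)) p (X p) =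
                g p (D X Y p) (Z p) + g p (Y p) (D X Z p)))"

definition cov1 ::
  "('a, 'e::euclidean_space) atlas \<Rightarrow> ('a, 'e) conn \<Rightarrow> ('a, 'e) form1 \<Rightarrow>
   ('a, 'e) vfield \<Rightarrow> ('a, 'e) vfield \<Rightarrow> 'a \<Rightarrow> real" where
  "cov1 A D \<alpha> X Y p = mderiv A (\<lambda>q. \<alpha> q (Y q)) p (X p) - \<alpha> p (D X Y p)"

definition cov2 ::
  "('a, 'e::euclidean_space) atlas \<Rightarrow> ('a, 'e) conn \<Rightarrow> ('a, 'e) form2 \<Rightarrow>
   ('a, 'e) vfield \<Rightarrow> ('a, 'e) vfield \<Rightarrow> ('a, 'e) vfield \<Rightarrow> 'a \<Rightarrow> real" where
  "cov2 A D F X Y Z p =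
     mderiv A (\<lambda>q. F q (Y q) (Z q)) p (X p) - F p (D X Y p) (Z p) - F p (Y p) (D X Z p)"

definition local_orthonormal_frame ::
  "('a::topological_space, 'e::euclidean_space) atlas \<Rightarrow> ('a, 'e) form2 \<Rightarrow> 'a \<Rightarrow>
   (nat \<Rightarrow> ('a, 'e) vfield) \<Rightarrow> bool" where
  "local_orthonormal_frame A g p E \<longleftrightarrow>
     (\<exists>U. open U \<and> p \<in> U \<and> (\<forall>i<DIM('e). smooth_vf A U (E i)) \<and>
        (\<forall>q\<in>U. \<forall>i<DIM('e). \<forall>j<DIM('e). g q (E i q) (E j q) = (if i = j then 1 else 0)))"

text \<open>\<open>(\<nabla>\<^sub>X \<alpha>)(Y)\<close>, \<open>(\<nabla>\<^sub>X F)(Y, Z)\<close> and the codifferentials are tensorial, so the frame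
  and the local field extending a given tangent vector can be chosen arbitrarily.\<close>

definition some_frame ::
  "('a::topological_space, 'e::euclidean_space) atlas \<Rightarrow> ('a, 'e) form2 \<Rightarrow> 'a \<Rightarrow>
   nat \<Rightarrow> ('a, 'e) vfield" where
  "some_frame A g p = (SOME E. local_orthonormal_frame A g p E)"

definition local_ext ::
  "('a::topological_space, 'e::euclidean_space) atlas \<Rightarrow> 'a \<Rightarrow> 'e \<Rightarrow> ('a, 'e) vfield" where
  "local_ext A p v = (SOME X. X p = v \<and> (\<exists>U. open U \<and> p \<in> U \<and> smooth_vf A U X))"

definition codiff1 ::
  "('a::topological_space, 'e::euclidean_space) atlas \<Rightarrow> ('a, 'e) form2 \<Rightarrow> ('a, 'e) conn \<Rightarrow>
   ('a, 'e) form1 \<Rightarrow> 'a \<Rightarrow> real" where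
  "codiff1 A g D \<alpha> p =
     - (\<Sum>i<DIM('e). cov1 A D \<alpha> (some_frame A g p i) (some_frame A g p i) p)"

definition codiff2 ::
  "('a::topological_space, 'e::euclidean_space) atlas \<Rightarrow> ('a, 'e) form2 \<Rightarrow> ('a, 'e) conn \<Rightarrow>
   ('a, 'e) form2 \<Rightarrow> ('a, 'e) form1" where
  "codiff2 A g D F p v =
     - (\<Sum>i<DIM('e).
          cov2 A D F (some_frame A g p i) (some_frame A g p i) (local_ext A p v) p)"


section \<open>Almost contact metric and almost Hermitian manifolds\<close>

definition fundamental_form :: "('a, 'e) form2 \<Rightarrow> ('a, 'e) endo \<Rightarrow> ('a, 'e) form2" where
  "fundamental_form g F p u v = g p u (F p v)"

definition almost_contact_metric ::
  "('a::{t2_space,second_countable_topology}, 'e::euclidean_space) atlas \<Rightarrow> ('a, 'e) endo \<Rightarrow>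
   ('a, 'e) vfield \<Rightarrow> ('a, 'e) form1 \<Rightarrow> ('a, 'e) form2 \<Rightarrow> bool" where
  "almost_contact_metric A \<phi> \<xi> \<eta> g \<longleftrightarrow>
     smooth_manifold A \<and> odd (DIM('e)) \<and> riemannian_metric A g \<and>
     endo_field A \<phi> \<and> smooth_vf A UNIV \<xi> \<and> one_form A \<eta> \<and>
     (\<forall>p v. \<phi> p (\<phi> p v) = - v + \<eta> p v *\<^sub>R \<xi> p) \<and>
     (\<forall>p. \<eta> p (\<xi> p) = 1) \<and>
     (\<forall>p u v. g p (\<phi> p u) (\<phi> p v) = g p u v - \<eta> p u * \<eta> p v)"

text \<open>The Lee form of an almost contact metric manifold of dimension \<open>2 m + 1\<close>, \<open>m \<ge> 2\<close>.\<close>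

definition acm_lee_form ::
  "('a::topological_space, 'e::euclidean_space) atlas \<Rightarrow> ('a, 'e) endo \<Rightarrow>
   ('a, 'e) vfield \<Rightarrow> ('a, 'e) form1 \<Rightarrow> ('a, 'e) form2 \<Rightarrow> ('a, 'e) conn \<Rightarrow> nat \<Rightarrow>
   ('a, 'e) form1" where
  "acm_lee_form A \<phi> \<xi> \<eta> g D m p v =
     - (1 / (2 * (real m - 1))) *
         (codiff2 A g D (fundamental_form g \<phi>) p (\<phi> p v) + cov1 A D \<eta> \<xi> (local_ext A p v) p)
     + codiff1 A g D \<eta> p / (2 * real m) * \<eta> p v"

definition almost_hermitian ::
  "('a::{t2_space,second_countable_topology}, 'e::euclidean_space) atlas \<Rightarrow> ('a, 'e) endo \<Rightarrow>
   ('a, 'e) form2 \<Rightarrow> bool" where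
  "almost_hermitian A J g \<longleftrightarrow>
     smooth_manifold A \<and> riemannian_metric A g \<and> endo_field A J \<and>
     (\<forall>p v. J p (J p v) = - v) \<and>
     (\<forall>p u v. g p (J p u) (J p v) = g p u v)"

text \<open>The Lee form of an almost Hermitian manifold of dimension \<open>2 n\<close>, \<open>n \<ge> 2\<close>.\<close>

definition ah_lee_form ::
  "('a::topological_space, 'e::euclidean_space) atlas \<Rightarrow> ('a, 'e) endo \<Rightarrow>
   ('a, 'e) form2 \<Rightarrow> ('a, 'e) conn \<Rightarrow> nat \<Rightarrow> ('a, 'e) form1" where
  "ah_lee_form A J g D n p v =
     - (1 / (2 * (real n - 1))) * codiff2 A g D (fundamental_form g J) p (J p v)"

text \<open>The criterion \<open>d\<Omega> = -2 \<theta> \<and> \<Omega>\<close> describes the class \<open>W\<^sub>2 \<oplus> W\<^sub>4\<close> in dimension at least 4.\<close>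

definition gray_hervella_W2_W4 ::
  "('a::{t2_space,second_countable_topology}, 'e::euclidean_space) atlas \<Rightarrow> ('a, 'e) endo \<Rightarrow>
   ('a, 'e) form2 \<Rightarrow> bool" where
  "gray_hervella_W2_W4 A J g \<longleftrightarrow>
     almost_hermitian A J g \<and>
     (\<exists>\<theta>. one_form A \<theta> \<and> lee_equation A \<theta> (fundamental_form g J))"


section \<open>Contact-complex Riemannian submersions\<close>

definition horizontal ::
  "('a, 'e::euclidean_space) atlas \<Rightarrow> ('a, 'e) form2 \<Rightarrow> ('b, 'f::euclidean_space) atlas \<Rightarrow>
   ('a \<Rightarrow> 'b) \<Rightarrow> 'a \<Rightarrow> 'e \<Rightarrow> bool" where
  "horizontal A g B \<pi> p u \<longleftrightarrow> (\<forall>v. tangent_map A B \<pi> p v = 0 \<longrightarrow> g p u v = 0)"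

definition riemannian_submersion ::
  "('a::topological_space, 'e::euclidean_space) atlas \<Rightarrow> ('a, 'e) form2 \<Rightarrow>
   ('b::topological_space, 'f::euclidean_space) atlas \<Rightarrow> ('b, 'f) form2 \<Rightarrow> ('a \<Rightarrow> 'b) \<Rightarrow> bool" where
  "riemannian_submersion A g B g' \<pi> \<longleftrightarrow>
     smooth_map A B \<pi> \<and> surj \<pi> \<and> (\<forall>p. surj (tangent_map A B \<pi> p)) \<and>
     (\<forall>p u v. horizontal A g B \<pi> p u \<longrightarrow> horizontal A g B \<pi> p v \<longrightarrow>
        g' (\<pi> p) (tangent_map A B \<pi> p u) (tangent_map A B \<pi> p v) = g p u v)"

definition contact_complex_submersion ::
  "('a::{t2_space,second_countable_topology}, 'e::euclidean_space) atlas \<Rightarrow> ('a, 'e) endo \<Rightarrow>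
   ('a, 'e) vfield \<Rightarrow> ('a, 'e) form1 \<Rightarrow> ('a, 'e) form2 \<Rightarrow>
   ('b::{t2_space,second_countable_topology}, 'f::euclidean_space) atlas \<Rightarrow> ('b, 'f) endo \<Rightarrow>
   ('b, 'f) form2 \<Rightarrow> ('a \<Rightarrow> 'b) \<Rightarrow> bool" where
  "contact_complex_submersion A \<phi> \<xi> \<eta> g B J g' \<pi> \<longleftrightarrow>
     almost_contact_metric A \<phi> \<xi> \<eta> g \<and> almost_hermitian B J g' \<and>
     riemannian_submersion A g B g' \<pi> \<and>
     (\<forall>p v. J (\<pi> p) (tangent_map A B \<pi> p v) = tangent_map A B \<pi> p (\<phi> p v))"

definition basic_field ::
  "('a::topological_space, 'e::euclidean_space) atlas \<Rightarrow> ('a, 'e) form2 \<Rightarrow>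
   ('b::topological_space, 'f::euclidean_space) atlas \<Rightarrow> ('a \<Rightarrow> 'b) \<Rightarrow>
   ('a, 'e) vfield \<Rightarrow> ('b, 'f) vfield \<Rightarrow> bool" where
  "basic_field A g B \<pi> X X' \<longleftrightarrow>
     smooth_vf A UNIV X \<and> smooth_vf B UNIV X' \<and>
     (\<forall>p. horizontal A g B \<pi> p (X p)) \<and>
     (\<forall>p. tangent_map A B \<pi> p (X p) = X' (\<pi> p))"

end

theory Submission imports Defs begin

text \<open>Let \<open>\<Phi>\<close> and \<open>\<Omega>\<close> be the fundamental forms of the total space and of the base. On horizontal
  vectors \<open>\<Phi>\<close> is the pullback of \<open>\<Omega>\<close>, because \<open>\<pi>\<close> is isometric there and intertwines \<open>\<phi>\<close> with \<open>J\<close>.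
  The difference \<open>\<Phi> - \<pi>\<^sup>*\<Omega>\<close> only sees vertical parts and is bilinear in them, so for two fields that are
  horizontal at \<open>p\<close> it vanishes at \<open>p\<close> to second order and its first derivatives do not contribute to
  \<open>d\<Phi>\<close> there (\<open>mderiv_\<Phi>_horizontal\<close>). Hence \<open>d\<Phi> = \<pi>\<^sup>*d\<Omega>\<close> on triples of horizontal vectors
  (\<open>ext_deriv2_\<Phi>_horizontal\<close>). As it is enough that the fields are horizontal at the single point
  \<open>p\<close>, they can be taken with constant components in a chart.

  The hypothesis \<open>d\<Phi> = -2 \<omega> \<and> \<Phi>\<close> therefore turns, for every \<open>p\<close> in the fibre over \<open>x\<close>, into
  \<open>d\<Omega> = -2 \<theta> \<and> \<Omega>\<close> at \<open>x\<close>, where \<open>\<theta>\<close> is \<open>\<omega>\<close> at \<open>p\<close> composed with the horizontal lift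
  (\<open>lee_equation_at_\<pi>\<close>). Contracting this identity over the pairs \<open>e\<^sub>i\<close>, \<open>J e\<^sub>i\<close> for an orthonormal frame gives
  \<open>4 (n - 1) \<theta>\<close> on the right. On the left it gives \<open>-2 \<delta>\<Omega> \<circ> J\<close>, by expressing \<open>d\<Omega>\<close> through the
  Levi-Civita connection (\<open>sum_ext_deriv2_frame\<close>). As \<open>n \<ge> 2\<close>, \<open>\<theta>\<close> is the Lee form \<open>\<beta>\<close> at \<open>x\<close>
  (\<open>lee_form_unique\<close>), which is the asserted equation between \<open>\<beta>\<close> and \<open>\<omega>\<close>. It also shows that \<open>\<beta>\<close>
  satisfies the Lee equation on the base, and being a contraction of \<open>d\<Omega>\<close> over a smooth frame, \<open>\<beta>\<close> is
  smooth (\<open>W2_W4_pointwise\<close>); so the base is of class \<open>W\<^sub>2 \<oplus> W\<^sub>4\<close>.\<close>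

section \<open>Calculus of smooth functions\<close>

abbreviation dderiv :: "('e::real_normed_vector \<Rightarrow> 'b::real_normed_vector) \<Rightarrow> 'e \<Rightarrow> 'e \<Rightarrow> 'b" where
  "dderiv f x v \<equiv> frechet_derivative f (at x) v"

lemma dderiv_eq: "(f has_derivative f') (at x) \<Longrightarrow> dderiv f x v = f' v"
  using frechet_derivative_at by metis

lemma dderiv_cong:
  assumes "open S" "x \<in> S" "\<And>y. y \<in> S \<Longrightarrow> f y = g y"
  shows "(f has_derivative F) (at x) \<longleftrightarrow> (g has_derivative F) (at x)"
    and "frechet_derivative f (at x) = frechet_derivative g (at x)"
proof -
  have *: "(f has_derivative F) (at x) \<longleftrightarrow> (g has_derivative F) (at x)" for F
    using assms has_derivative_transform_within_open[of f F x UNIV S g]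
      has_derivative_transform_within_open[of g F x UNIV S f] by auto
  show "(f has_derivative F) (at x) \<longleftrightarrow> (g has_derivative F) (at x)" by (rule *)
  show "frechet_derivative f (at x) = frechet_derivative g (at x)"
    unfolding frechet_derivative_def using * by simp
qed

lemma differentiable_cong_open:
  assumes "open S" "x \<in> S" "\<And>y. y \<in> S \<Longrightarrow> f y = g y"
  shows "f differentiable (at x) \<longleftrightarrow> g differentiable (at x)"
  unfolding differentiable_def using dderiv_cong(1)[OF assms] by simp

lemma Ck_on_cong:
  assumes "open S" "\<And>x. x \<in> S \<Longrightarrow> f x = g x"
  shows "Ck_on k S f \<longleftrightarrow> Ck_on k S g"
  using assms(2)
proof (induction k arbitrary: f g)
  case 0
  then show ?case using continuous_on_cong by (metis Ck_on.simps(1))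
next
  case (Suc k)
  have 1: "f differentiable (at x) \<longleftrightarrow> g differentiable (at x)" if "x \<in> S" for x
    using differentiable_cong_open[OF assms(1) that Suc.prems] .
  have 2: "Ck_on k S (\<lambda>x. dderiv f x v) \<longleftrightarrow> Ck_on k S (\<lambda>x. dderiv g x v)" for v
  proof (rule Suc.IH)
    show "dderiv f x v = dderiv g x v" if "x \<in> S" for x
      using dderiv_cong(2)[OF assms(1) that Suc.prems] by simp
  qed
  show ?case using 1 2 by auto
qed

lemma Ck_on_subset: "Ck_on k S f \<Longrightarrow> T \<subseteq> S \<Longrightarrow> Ck_on k T f"
  by (induction k arbitrary: f) (auto intro: continuous_on_subset)

lemma Ck_on_SucI:
  assumes "open S" "\<And>x. x \<in> S \<Longrightarrow> (f has_derivative f' x) (at x)"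
    and "\<And>v. Ck_on k S (\<lambda>x. f' x v)"
  shows "Ck_on (Suc k) S f"
proof -
  have "Ck_on k S (\<lambda>x. dderiv f x v)" for v
    using assms(3)[of v] Ck_on_cong[OF assms(1), of "\<lambda>x. dderiv f x v" "\<lambda>x. f' x v"]
      dderiv_eq[OF assms(2)] by auto
  then show ?thesis using assms(2) by (auto simp: differentiable_def)
qed

lemma Ck_on_has_derivative:
  "Ck_on (Suc k) S f \<Longrightarrow> x \<in> S \<Longrightarrow> (f has_derivative dderiv f x) (at x)"
  by (simp add: frechet_derivative_works[symmetric])

lemma Ck_on_SucD: "Ck_on (Suc k) S f \<Longrightarrow> Ck_on k S f"
proof (induction k arbitrary: f)
  case 0
  have "continuous (at x) f" if "x \<in> S" for x
    using Ck_on_has_derivative[OF 0 that] by (rule has_derivative_continuous)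
  then show ?case unfolding Ck_on.simps(1) by (intro continuous_at_imp_continuous_on ballI)
next
  case (Suc k)
  then show ?case by auto
qed

lemma Ck_on_local:
  assumes "open S" "\<And>x. x \<in> S \<Longrightarrow> \<exists>T. open T \<and> x \<in> T \<and> Ck_on k (S \<inter> T) f"
  shows "Ck_on k S f"
  using assms(2)
proof (induction k arbitrary: f)
  case 0
  have "continuous (at x) f" if x: "x \<in> S" for x
  proof -
    obtain T where "open T" "x \<in> T" "continuous_on (S \<inter> T) f" using 0[OF x] by auto
    then show ?thesis using assms(1) x continuous_on_eq_continuous_at[of "S \<inter> T" f] by auto
  qed
  then show ?case using assms(1) by (simp add: continuous_on_eq_continuous_at)
next
  case (Suc k)
  have "f differentiable (at x)" if "x \<in> S" for x
    using Suc.prems[OF that] that by auto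
  moreover have "Ck_on k S (\<lambda>x. dderiv f x v)" for v
  proof (rule Suc.IH)
    fix x assume "x \<in> S"
    then obtain T where "open T" "x \<in> T" "Ck_on (Suc k) (S \<inter> T) f" using Suc.prems by blast
    then show "\<exists>T. open T \<and> x \<in> T \<and> Ck_on k (S \<inter> T) (\<lambda>x. dderiv f x v)" by auto
  qed
  ultimately show ?case by auto
qed

lemma Ck_on_const: "open S \<Longrightarrow> Ck_on k S (\<lambda>x. c)"
proof (induction k arbitrary: c)
  case (Suc k)
  then show ?case by (intro Ck_on_SucI[where f' = "\<lambda>x v. 0"]) auto
qed auto

lemma Ck_on_add:
  "open S \<Longrightarrow> Ck_on k S f \<Longrightarrow> Ck_on k S g \<Longrightarrow> Ck_on k S (\<lambda>x. f x + g x)"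
proof (induction k arbitrary: f g)
  case 0
  then show ?case by (auto intro: continuous_on_add)
next
  case (Suc k)
  show ?case
    using Suc by (intro Ck_on_SucI[where f' = "\<lambda>x v. dderiv f x v + dderiv g x v"])
      (auto intro!: has_derivative_add simp: frechet_derivative_works[symmetric])
qed

lemma Ck_on_bilinear:
  assumes "open S" "bounded_bilinear B"
  shows "Ck_on k S f \<Longrightarrow> Ck_on k S g \<Longrightarrow> Ck_on k S (\<lambda>x. B (f x) (g x))"
proof (induction k arbitrary: f g)
  case 0
  then show ?case using assms by (auto intro: bounded_bilinear.continuous_on)
next
  case (Suc k)
  have "Ck_on k S f" "Ck_on k S g" using Suc.prems Ck_on_SucD by blast+
  then show ?case
    using Suc
    by (intro Ck_on_SucI[where f' = "\<lambda>x v. B (f x) (dderiv g x v) + B (dderiv f x v) (g x)"])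
      (auto intro!: bounded_bilinear.FDERIV[OF assms(2)] Ck_on_add assms(1)
        simp: frechet_derivative_works[symmetric])
qed

lemma Ck_on_sum:
  "open S \<Longrightarrow> (\<And>i. i \<in> I \<Longrightarrow> Ck_on k S (f i)) \<Longrightarrow> Ck_on k S (\<lambda>x. \<Sum>i\<in>I. f i x)"
  by (induction I rule: infinite_finite_induct) (auto intro: Ck_on_const Ck_on_add)

lemma linear_eq_sum_Basis:
  fixes L :: "'e::euclidean_space \<Rightarrow> 'b::real_vector"
  assumes "linear L"
  shows "L v = (\<Sum>b\<in>Basis. (v \<bullet> b) *\<^sub>R L b)"
proof -
  have "L v = L (\<Sum>b\<in>Basis. (v \<bullet> b) *\<^sub>R b)" by (simp add: euclidean_representation)
  then show ?thesis using assms by (simp add: linear_sum linear_cmul)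
qed

text \<open>By the chain rule, a directional derivative of \<open>h \<circ> f\<close> is a sum over the basis of products of
  partial derivatives of \<open>h\<close>, composed with \<open>f\<close>, and components of the derivative of \<open>f\<close>. This is
  one order less in both functions.\<close>

lemma Ck_on_compose:
  fixes f :: "'e::euclidean_space \<Rightarrow> 'f::euclidean_space"
  assumes "open S" "open T" "f ` S \<subseteq> T"
  shows "Ck_on k S f \<Longrightarrow> Ck_on k T h \<Longrightarrow> Ck_on k S (\<lambda>x. h (f x))"
proof (induction k arbitrary: h)
  case 0
  then show ?case using assms(3) continuous_on_compose2 by (metis Ck_on.simps(1))
next
  case (Suc k)
  have *: "Ck_on k S f" using Suc.prems Ck_on_SucD by blast
  show ?case
  proof (rule Ck_on_SucI[OF assms(1)])
    show "((\<lambda>x. h (f x)) has_derivative (\<lambda>v. dderiv h (f x) (dderiv f x v))) (at x)" if "x \<in> S" for x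
    proof -
      have "(h has_derivative dderiv h (f x)) (at (f x))"
        using assms(3) that Suc.prems(2) Ck_on_has_derivative by blast
      then show ?thesis
        using has_derivative_compose[OF Ck_on_has_derivative[OF Suc.prems(1) that]] by blast
    qed
    fix v
    have "Ck_on k S (\<lambda>x. \<Sum>b\<in>Basis. (dderiv f x v \<bullet> b) *\<^sub>R dderiv h (f x) b)"
    proof (intro Ck_on_sum assms(1) Ck_on_bilinear[OF assms(1) bounded_bilinear_scaleR])
      fix b :: 'f
      have "Ck_on k S (\<lambda>x. dderiv f x v)" using Suc.prems by simp
      then show "Ck_on k S (\<lambda>x. dderiv f x v \<bullet> b)"
        by (rule Ck_on_bilinear[OF assms(1) bounded_bilinear_inner])
          (rule Ck_on_const[OF assms(1)])
      show "Ck_on k S (\<lambda>x. dderiv h (f x) b)"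
        using Suc.IH[OF *] Suc.prems(2) by auto
    qed
    moreover have "dderiv h (f x) (dderiv f x v) =
        (\<Sum>b\<in>Basis. (dderiv f x v \<bullet> b) *\<^sub>R dderiv h (f x) b)" if "x \<in> S" for x
    proof (rule linear_eq_sum_Basis, rule linear_frechet_derivative)
      show "h differentiable at (f x)" using Suc.prems(2) assms(3) that by auto
    qed
    ultimately show "Ck_on k S (\<lambda>x. dderiv h (f x) (dderiv f x v))"
      using Ck_on_cong[OF assms(1)] by (metis (no_types, lifting))
  qed
qed

lemma smooth_on_cong:
  "open S \<Longrightarrow> (\<And>x. x \<in> S \<Longrightarrow> f x = g x) \<Longrightarrow> smooth_on S f \<longleftrightarrow> smooth_on S g"
  unfolding smooth_on_def using Ck_on_cong by blast

lemma smooth_on_subset: "smooth_on S f \<Longrightarrow> T \<subseteq> S \<Longrightarrow> smooth_on T f"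
  unfolding smooth_on_def using Ck_on_subset by blast

lemma smooth_on_local:
  assumes "open S" "\<And>x. x \<in> S \<Longrightarrow> \<exists>T. open T \<and> x \<in> T \<and> smooth_on (S \<inter> T) f"
  shows "smooth_on S f"
  unfolding smooth_on_def
proof
  show "Ck_on k S f" for k
  proof (rule Ck_on_local[OF assms(1)])
    fix x assume "x \<in> S"
    then show "\<exists>T. open T \<and> x \<in> T \<and> Ck_on k (S \<inter> T) f"
      using assms(2) unfolding smooth_on_def by blast
  qed
qed

lemma smooth_on_const: "open S \<Longrightarrow> smooth_on S (\<lambda>x. c)"
  by (simp add: smooth_on_def Ck_on_const)

lemma smooth_on_add:
  "open S \<Longrightarrow> smooth_on S f \<Longrightarrow> smooth_on S g \<Longrightarrow> smooth_on S (\<lambda>x. f x + g x)"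
  by (simp add: smooth_on_def Ck_on_add)

lemma smooth_on_bilinear:
  "open S \<Longrightarrow> bounded_bilinear B \<Longrightarrow> smooth_on S f \<Longrightarrow> smooth_on S g \<Longrightarrow>
   smooth_on S (\<lambda>x. B (f x) (g x))"
  by (simp add: smooth_on_def Ck_on_bilinear)

lemma smooth_on_compose:
  fixes f :: "'e::euclidean_space \<Rightarrow> 'f::euclidean_space"
  shows "open S \<Longrightarrow> open T \<Longrightarrow> f ` S \<subseteq> T \<Longrightarrow> smooth_on S f \<Longrightarrow> smooth_on T h \<Longrightarrow>
    smooth_on S (\<lambda>x. h (f x))"
  by (simp add: smooth_on_def Ck_on_compose)

lemma smooth_on_has_derivative:
  "smooth_on S f \<Longrightarrow> x \<in> S \<Longrightarrow> (f has_derivative dderiv f x) (at x)"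
  unfolding smooth_on_def using Ck_on_has_derivative by blast

lemma smooth_on_dderiv: "smooth_on S f \<Longrightarrow> smooth_on S (\<lambda>x. dderiv f x v)"
  unfolding smooth_on_def by (metis Ck_on.simps(2))

lemma smooth_on_sum:
  "open S \<Longrightarrow> (\<And>i. i \<in> I \<Longrightarrow> smooth_on S (f i)) \<Longrightarrow> smooth_on S (\<lambda>x. \<Sum>i\<in>I. f i x)"
  by (simp add: smooth_on_def Ck_on_sum)

text \<open>The derivative of \<open>t \<mapsto> 1 / sqrt t\<close> is \<open>-1/2\<close> times its cube, so each order of
  differentiability gives the next one. The function normalises the vectors in the Gram-Schmidt
  process.\<close>

lemma smooth_on_inverse_sqrt: "smooth_on {0<..} (\<lambda>t::real. inverse (sqrt t))"
  unfolding smooth_on_def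
proof
  fix k
  let ?h = "\<lambda>t::real. inverse (sqrt t)"
  have op: "open {0::real<..}" by simp
  show "Ck_on k {0<..} ?h"
  proof (induction k)
    case 0
    then show ?case by (auto intro!: continuous_intros)
  next
    case (Suc k)
    show ?case
    proof (rule Ck_on_SucI[OF op])
      show "(?h has_derivative (\<lambda>v. (-1/2 * v) * (?h t * (?h t * ?h t)))) (at t)" if "t \<in> {0<..}" for t
      proof -
        have t: "t > 0" using that by simp
        have "(?h has_real_derivative (- (inverse (sqrt t) * (inverse (sqrt t) / 2) * inverse (sqrt t)))) (at t)"
          using t by (auto intro!: derivative_eq_intros)
        then show ?thesis
          unfolding has_field_derivative_def
          by (rule has_derivative_eq_rhs) (auto simp: fun_eq_iff)
      qed
      show "Ck_on k {0<..} (\<lambda>t. (-1/2 * v) * (?h t * (?h t * ?h t)))" for v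
        by (intro Ck_on_bilinear[OF op bounded_bilinear_mult] Ck_on_const[OF op] Suc.IH)
    qed
  qed
qed

text \<open>The two iterated derivatives agree because both are limits of the second difference
  \<open>(f (x + h u + h v) - f (x + h u) - f (x + h v) + f x) / h\<^sup>2\<close>: it is symmetric in
  \<open>u\<close> and \<open>v\<close>, and the mean value theorem, applied first along \<open>u\<close> and then along \<open>v\<close>, shows that it is
  a value of \<open>D\<^sub>v D\<^sub>u f\<close> near \<open>x\<close>.\<close>

lemma second_difference:
  fixes f :: "'e::euclidean_space \<Rightarrow> real"
  assumes "Ck_on 2 (ball x r) f" "h > 0" "h * norm u + h * norm v < r"
  obtains s t where "0 < s" "s < h" "0 < t" "t < h"
    "f (x + h *\<^sub>R u + h *\<^sub>R v) - f (x + h *\<^sub>R u) - f (x + h *\<^sub>R v) + f x =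
     h * h * dderiv (\<lambda>y. dderiv f y u) (x + s *\<^sub>R u + t *\<^sub>R v) v"
proof -
  have ball: "x + s *\<^sub>R u + t *\<^sub>R v \<in> ball x r" if "0 \<le> s" "s \<le> h" "0 \<le> t" "t \<le> h" for s t
  proof -
    have "dist x (x + s *\<^sub>R u + t *\<^sub>R v) = norm (s *\<^sub>R u + t *\<^sub>R v)"
      using norm_minus_cancel[of "s *\<^sub>R u + t *\<^sub>R v"] by (simp add: dist_norm add.commute)
    also have "\<dots> \<le> s * norm u + t * norm v"
      using norm_triangle_ineq[of "s *\<^sub>R u" "t *\<^sub>R v"] that by simp
    also have "\<dots> \<le> h * norm u + h * norm v"
      using that by (intro add_mono mult_right_mono) auto
    finally show ?thesis using assms(3) by simp
  qed
  have f1: "(f has_derivative dderiv f y) (at y)" if "y \<in> ball x r" for y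
    using assms(1) that by (simp add: numeral_2_eq_2 frechet_derivative_works[symmetric])
  have f2: "((\<lambda>y. dderiv f y u) has_derivative dderiv (\<lambda>y. dderiv f y u) y) (at y)" if "y \<in> ball x r" for y
    using assms(1) that by (simp add: numeral_2_eq_2 frechet_derivative_works[symmetric])
  have lin: "linear (dderiv f y)" "linear (dderiv (\<lambda>y. dderiv f y u) y)" if "y \<in> ball x r" for y
    using f1[OF that] f2[OF that] has_derivative_linear by blast+
  define F where "F s = f (x + s *\<^sub>R u + h *\<^sub>R v) - f (x + s *\<^sub>R u + 0 *\<^sub>R v)" for s
  have F': "(F has_derivative (\<lambda>k. k * (dderiv f (x + s *\<^sub>R u + h *\<^sub>R v) u -
      dderiv f (x + s *\<^sub>R u + 0 *\<^sub>R v) u))) (at s)" if "0 \<le> s" "s \<le> h" for s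
  proof -
    have *: "((\<lambda>s. f (x + s *\<^sub>R u + t *\<^sub>R v)) has_derivative
        (\<lambda>k. k * dderiv f (x + s *\<^sub>R u + t *\<^sub>R v) u)) (at s)" if "0 \<le> t" "t \<le> h" for t
    proof -
      have b: "x + s *\<^sub>R u + t *\<^sub>R v \<in> ball x r" using that \<open>0 \<le> s\<close> \<open>s \<le> h\<close> ball by simp
      have "((\<lambda>s. x + s *\<^sub>R u + t *\<^sub>R v) has_derivative (\<lambda>k. k *\<^sub>R u)) (at s)"
        by (auto intro!: derivative_eq_intros)
      from has_derivative_compose[OF this f1[OF b]] show ?thesis
        by (simp add: linear_cmul[OF lin(1)[OF b]])
    qed
    show ?thesis unfolding F_def
      by (rule has_derivative_eq_rhs, rule has_derivative_diff[OF *[of h] *[of 0]])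
        (use assms(2) in \<open>auto simp: algebra_simps\<close>)
  qed
  obtain s where s: "0 < s" "s < h" and Fs: "F h - F 0 = h * (dderiv f (x + s *\<^sub>R u + h *\<^sub>R v) u -
      dderiv f (x + s *\<^sub>R u + 0 *\<^sub>R v) u)"
    using mvt_simple[OF assms(2), of F, OF has_derivative_at_withinI[OF F']] by auto
  define G where "G t = dderiv f (x + s *\<^sub>R u + t *\<^sub>R v) u" for t
  have G': "(G has_derivative (\<lambda>k. k * dderiv (\<lambda>y. dderiv f y u) (x + s *\<^sub>R u + t *\<^sub>R v) v)) (at t)"
    if "0 \<le> t" "t \<le> h" for t
  proof -
    have b: "x + s *\<^sub>R u + t *\<^sub>R v \<in> ball x r" using that s ball by simp
    have "((\<lambda>t. x + s *\<^sub>R u + t *\<^sub>R v) has_derivative (\<lambda>k. k *\<^sub>R v)) (at t)"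
      by (auto intro!: derivative_eq_intros)
    from has_derivative_compose[OF this f2[OF b]] show ?thesis unfolding G_def
      by (simp add: linear_cmul[OF lin(2)[OF b]])
  qed
  obtain t where t: "0 < t" "t < h" and "G h - G 0 =
      h * dderiv (\<lambda>y. dderiv f y u) (x + s *\<^sub>R u + t *\<^sub>R v) v"
    using mvt_simple[OF assms(2), of G, OF has_derivative_at_withinI[OF G']] by auto
  then have "F h - F 0 = h * h * dderiv (\<lambda>y. dderiv f y u) (x + s *\<^sub>R u + t *\<^sub>R v) v"
    using Fs by (simp add: G_def)
  then show ?thesis using that[OF s t] by (simp add: F_def algebra_simps)
qed

lemma symmetric_second_derivative_real:
  fixes f :: "'e::euclidean_space \<Rightarrow> real"
  assumes "Ck_on 2 S f" "open S" "x \<in> S"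
  shows "dderiv (\<lambda>y. dderiv f y u) x v = dderiv (\<lambda>y. dderiv f y v) x u"
proof (rule ccontr)
  let ?P = "\<lambda>y. dderiv (\<lambda>y. dderiv f y u) y v" and ?Q = "\<lambda>y. dderiv (\<lambda>y. dderiv f y v) y u"
  assume ne: "?P x \<noteq> ?Q x"
  define e where "e = \<bar>?P x - ?Q x\<bar> / 2"
  have e: "e > 0" using ne by (simp add: e_def)
  have "continuous_on S ?P" "continuous_on S ?Q" using assms(1) by (auto simp: numeral_2_eq_2)
  then have cont: "continuous (at x) ?P" "continuous (at x) ?Q"
    using assms continuous_on_eq_continuous_at by blast+
  obtain d1 where d1: "d1 > 0" "\<And>y. dist y x < d1 \<Longrightarrow> dist (?P y) (?P x) < e"
    using cont(1) e unfolding continuous_at_eps_delta by metis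
  obtain d2 where d2: "d2 > 0" "\<And>y. dist y x < d2 \<Longrightarrow> dist (?Q y) (?Q x) < e"
    using cont(2) e unfolding continuous_at_eps_delta by metis
  obtain d3 where d3: "d3 > 0" "ball x d3 \<subseteq> S" using assms(2,3) openE by metis
  define r where "r = min d1 (min d2 d3)"
  have r: "r > 0" using d1 d2 d3 by (simp add: r_def)
  define h where "h = r / (2 * (norm u + norm v + 1))"
  have pos: "norm u + norm v + 1 > 0" by (simp add: add_nonneg_pos)
  have h: "h > 0" using r pos by (simp add: h_def)
  have "h * (norm u + norm v) \<le> h * (norm u + norm v + 1)" using h by simp
  also have "\<dots> = r / 2" using pos by (simp add: h_def field_simps)
  also have "\<dots> < r" using r by simp
  finally have hr: "h * norm u + h * norm v < r" by (simp add: distrib_left)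
  have "ball x r \<subseteq> S" using d3 by (auto simp: r_def)
  then have C: "Ck_on 2 (ball x r) f" using Ck_on_subset assms(1) by blast
  have near: "dist (x + s *\<^sub>R a + t *\<^sub>R b) x < r"
    if "0 < s" "s < h" "0 < t" "t < h" "h * norm a + h * norm b < r" for s t a b
  proof -
    have "dist (x + s *\<^sub>R a + t *\<^sub>R b) x \<le> s * norm a + t * norm b"
      using norm_triangle_ineq[of "s *\<^sub>R a" "t *\<^sub>R b"] that by (simp add: dist_norm)
    also have "\<dots> \<le> h * norm a + h * norm b"
      using that by (intro add_mono mult_right_mono) auto
    finally show ?thesis using that by simp
  qed
  obtain s t where 1: "0 < s" "s < h" "0 < t" "t < h"
    and e1: "f (x + h *\<^sub>R u + h *\<^sub>R v) - f (x + h *\<^sub>R u) - f (x + h *\<^sub>R v) + f x =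
      h * h * ?P (x + s *\<^sub>R u + t *\<^sub>R v)"
    using second_difference[OF C h hr] by blast
  obtain s' t' where 2: "0 < s'" "s' < h" "0 < t'" "t' < h"
    and e2: "f (x + h *\<^sub>R v + h *\<^sub>R u) - f (x + h *\<^sub>R v) - f (x + h *\<^sub>R u) + f x =
      h * h * ?Q (x + s' *\<^sub>R v + t' *\<^sub>R u)"
    using second_difference[OF C h] hr by (metis add.commute)
  have e1': "h * h * ?P (x + s *\<^sub>R u + t *\<^sub>R v) =
      f (x + (h *\<^sub>R u + h *\<^sub>R v)) - f (x + h *\<^sub>R u) - f (x + h *\<^sub>R v) + f x"
    using e1 by (simp add: add.assoc)
  have e2': "h * h * ?Q (x + s' *\<^sub>R v + t' *\<^sub>R u) =
      f (x + (h *\<^sub>R u + h *\<^sub>R v)) - f (x + h *\<^sub>R u) - f (x + h *\<^sub>R v) + f x"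
    using e2 by (simp add: add.assoc add.commute[of "h *\<^sub>R v"])
  have "h * h * ?P (x + s *\<^sub>R u + t *\<^sub>R v) = h * h * ?Q (x + s' *\<^sub>R v + t' *\<^sub>R u)"
    using e1' e2' by simp
  then have eq: "?P (x + s *\<^sub>R u + t *\<^sub>R v) = ?Q (x + s' *\<^sub>R v + t' *\<^sub>R u)"
    using h by simp
  have "dist (?P (x + s *\<^sub>R u + t *\<^sub>R v)) (?P x) < e"
    using d1(2) near[OF 1 hr] by (simp add: r_def)
  moreover have "dist (?Q (x + s' *\<^sub>R v + t' *\<^sub>R u)) (?Q x) < e"
    using d2(2) near[OF 2] hr by (simp add: r_def add.commute)
  ultimately have "\<bar>?P x - ?Q x\<bar> < 2 * e" using eq by (simp add: dist_real_def)
  then show False by (simp add: e_def)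
qed

lemma symmetric_second_derivative:
  fixes f :: "'e::euclidean_space \<Rightarrow> 'f::euclidean_space"
  assumes "smooth_on S f" "open S" "x \<in> S"
  shows "dderiv (\<lambda>y. dderiv f y u) x v = dderiv (\<lambda>y. dderiv f y v) x u"
proof (rule euclidean_eqI)
  fix b :: 'f
  assume "b \<in> Basis"
  have inner: "dderiv (\<lambda>y. F y \<bullet> b) y w = dderiv F y w \<bullet> b"
    if "smooth_on S F" "y \<in> S" for F :: "'e \<Rightarrow> 'f" and y w
    by (rule dderiv_eq, rule has_derivative_inner_left, rule smooth_on_has_derivative) fact+
  have *: "dderiv (\<lambda>y. dderiv (\<lambda>y. f y \<bullet> b) y u) x v = dderiv (\<lambda>y. dderiv f y u) x v \<bullet> b" for u v
  proof -
    have "dderiv (\<lambda>y. dderiv (\<lambda>y. f y \<bullet> b) y u) x v = dderiv (\<lambda>y. dderiv f y u \<bullet> b) x v"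
      using dderiv_cong(2)[OF assms(2,3)] inner[OF assms(1)] by (metis (no_types, lifting))
    also have "\<dots> = dderiv (\<lambda>y. dderiv f y u) x v \<bullet> b"
      by (rule inner[OF smooth_on_dderiv[OF assms(1)] assms(3)])
    finally show ?thesis .
  qed
  have "smooth_on S (\<lambda>y. f y \<bullet> b)"
    by (rule smooth_on_bilinear[OF assms(2) bounded_bilinear_inner assms(1) smooth_on_const[OF assms(2)]])
  then have "Ck_on 2 S (\<lambda>y. f y \<bullet> b)" by (simp add: smooth_on_def)
  from symmetric_second_derivative_real[OF this assms(2,3), of u v]
  show "dderiv (\<lambda>y. dderiv f y u) x v \<bullet> b = dderiv (\<lambda>y. dderiv f y v) x u \<bullet> b"
    by (simp only: *)
qed

section \<open>Functions and vector fields on a manifold\<close>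

text \<open>The field with constant components \<open>u\<close> in the chart \<open>c\<close>; as tangent vectors at \<open>q\<close> are given in
  the preferred chart at \<open>q\<close>, this is the derivative of the change of coordinates.\<close>

definition coord_field :: "('a, 'e::euclidean_space) atlas \<Rightarrow> ('a, 'e) chart \<Rightarrow> 'e \<Rightarrow> ('a, 'e) vfield" where
  "coord_field A c u q = dderiv (snd (chart_at A q) \<circ> chart_inv c) (snd c q) u"

locale smooth_atlas =
  fixes A :: "('a::{t2_space,second_countable_topology}, 'e::euclidean_space) atlas"
  assumes smooth_manifold: "smooth_manifold A"
begin

lemma chart_at: "chart_at A p \<in> A" "p \<in> fst (chart_at A p)"
proof -
  have "\<exists>c. c \<in> A \<and> p \<in> fst c"
    using smooth_manifold unfolding smooth_manifold_def by blast
  from someI_ex[OF this] show "chart_at A p \<in> A" "p \<in> fst (chart_at A p)"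
    unfolding chart_at_def by auto
qed

lemma chart_homeo:
  "c \<in> A \<Longrightarrow> homeomorphism (fst c) (snd c ` fst c) (snd c) (chart_inv c)"
  using smooth_manifold unfolding smooth_manifold_def by blast

lemma open_dom: "c \<in> A \<Longrightarrow> open (fst c)"
  and open_range: "c \<in> A \<Longrightarrow> open (snd c ` fst c)"
  using smooth_manifold unfolding smooth_manifold_def by blast+

lemma chart_inv_chart: "c \<in> A \<Longrightarrow> p \<in> fst c \<Longrightarrow> chart_inv c (snd c p) = p"
  using chart_homeo homeomorphism_apply1 by metis

lemma chart_chart_inv:
  assumes "c \<in> A" "x \<in> snd c ` (fst c \<inter> U)"
  shows "snd c (chart_inv c x) = x" "chart_inv c x \<in> fst c \<inter> U"
  using assms(2) chart_inv_chart[OF assms(1)] by auto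

lemma open_image:
  assumes "c \<in> A" "open U"
  shows "open (snd c ` (fst c \<inter> U))"
proof -
  have "snd c ` (fst c \<inter> U) = chart_inv c -` U \<inter> snd c ` fst c"
    using chart_inv_chart[OF assms(1)] by auto
  moreover have "continuous_on (snd c ` fst c) (chart_inv c)"
    using chart_homeo[OF assms(1)] by (simp add: homeomorphism_def)
  ultimately show ?thesis
    using open_range[OF assms(1)] assms(2) continuous_on_open_vimage by metis
qed

lemma open_image': "c \<in> A \<Longrightarrow> open U \<Longrightarrow> U \<subseteq> fst c \<Longrightarrow> open (snd c ` U)"
  using open_image by (metis inf.absorb2)

lemma smooth_transition:
  "c \<in> A \<Longrightarrow> d \<in> A \<Longrightarrow> smooth_on (snd c ` (fst c \<inter> fst d)) (snd d \<circ> chart_inv c)"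
  using smooth_manifold unfolding smooth_manifold_def by blast

lemma msmooth_onD:
  "msmooth_on A U f \<Longrightarrow> c \<in> A \<Longrightarrow> smooth_on (snd c ` (fst c \<inter> U)) (f \<circ> chart_inv c)"
  by (simp add: msmooth_on_def)

lemma msmooth_on_chartI:
  assumes "c \<in> A" "open U" "U \<subseteq> fst c" "smooth_on (snd c ` U) (f \<circ> chart_inv c)"
  shows "msmooth_on A U f"
  unfolding msmooth_on_def
proof
  fix d assume d: "d \<in> A"
  let ?S = "snd d ` (fst d \<inter> U)"
  have S: "open ?S" using open_image[OF d assms(2)] .
  have "smooth_on ?S (snd c \<circ> chart_inv d)"
    by (rule smooth_on_subset[OF smooth_transition[OF d assms(1)]], rule image_mono)
      (use assms(3) in auto)
  moreover have im: "(snd c \<circ> chart_inv d) ` ?S \<subseteq> snd c ` U"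
  proof (intro subsetI, elim imageE)
    fix y x q assume "y = (snd c \<circ> chart_inv d) x" "x = snd d q" "q \<in> fst d \<inter> U"
    then show "y \<in> snd c ` U" using chart_inv_chart[OF d, of q] by simp
  qed
  ultimately have "smooth_on ?S (\<lambda>x. (f \<circ> chart_inv c) ((snd c \<circ> chart_inv d) x))"
    using smooth_on_compose[OF S open_image'[OF assms(1-3)] im _ assms(4)] by blast
  moreover have "(f \<circ> chart_inv c) ((snd c \<circ> chart_inv d) x) = (f \<circ> chart_inv d) x" if "x \<in> ?S" for x
    using that chart_inv_chart[OF d] chart_inv_chart[OF assms(1)] assms(3) by auto
  ultimately show "smooth_on ?S (f \<circ> chart_inv d)"
    using smooth_on_cong[OF S] by (metis (no_types, lifting))
qed

lemma msmooth_on_chart_iff: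
  assumes "c \<in> A" "open U" "U \<subseteq> fst c"
  shows "msmooth_on A U f \<longleftrightarrow> smooth_on (snd c ` U) (f \<circ> chart_inv c)"
  using msmooth_on_chartI[OF assms] msmooth_onD[OF _ assms(1)] assms(3) by (metis inf.absorb2)

lemma msmooth_on_cong:
  assumes "open U" "\<And>p. p \<in> U \<Longrightarrow> f p = g p"
  shows "msmooth_on A U f \<longleftrightarrow> msmooth_on A U g"
  unfolding msmooth_on_def
proof (rule ball_cong[OF refl])
  fix c assume c: "c \<in> A"
  show "smooth_on (snd c ` (fst c \<inter> U)) (f \<circ> chart_inv c) \<longleftrightarrow>
      smooth_on (snd c ` (fst c \<inter> U)) (g \<circ> chart_inv c)"
  proof (rule smooth_on_cong[OF open_image[OF c assms(1)]])
    show "(f \<circ> chart_inv c) x = (g \<circ> chart_inv c) x" if "x \<in> snd c ` (fst c \<inter> U)" for x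
      using chart_chart_inv(2)[OF c that] assms(2) by simp
  qed
qed

lemma msmooth_on_subset: "msmooth_on A U f \<Longrightarrow> V \<subseteq> U \<Longrightarrow> msmooth_on A V f"
  unfolding msmooth_on_def by (meson Int_mono image_mono smooth_on_subset subset_refl)

lemma msmooth_on_local:
  assumes "open U" "\<And>p. p \<in> U \<Longrightarrow> \<exists>V. open V \<and> p \<in> V \<and> msmooth_on A (U \<inter> V) f"
  shows "msmooth_on A U f"
  unfolding msmooth_on_def
proof
  fix c assume c: "c \<in> A"
  show "smooth_on (snd c ` (fst c \<inter> U)) (f \<circ> chart_inv c)"
  proof (rule smooth_on_local[OF open_image[OF c assms(1)]])
    fix x assume x: "x \<in> snd c ` (fst c \<inter> U)"
    obtain V where V: "open V" "chart_inv c x \<in> V" "msmooth_on A (U \<inter> V) f"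
      using assms(2) chart_chart_inv(2)[OF c x] by blast
    let ?T = "snd c ` (fst c \<inter> (U \<inter> V))"
    have "open ?T" using open_image[OF c] assms(1) V(1) by blast
    moreover have "x \<in> ?T" using chart_chart_inv[OF c x] V(2) by (metis Int_iff image_eqI)
    moreover have "smooth_on (snd c ` (fst c \<inter> U) \<inter> ?T) (f \<circ> chart_inv c)"
      by (rule smooth_on_subset[OF msmooth_onD[OF V(3) c]]) simp
    ultimately show "\<exists>T. open T \<and> x \<in> T \<and> smooth_on (snd c ` (fst c \<inter> U) \<inter> T) (f \<circ> chart_inv c)"
      by blast
  qed
qed

lemma msmooth_on_const: "open U \<Longrightarrow> msmooth_on A U (\<lambda>p. k)"
  unfolding msmooth_on_def o_def using open_image smooth_on_const by blast

lemma msmooth_on_bilinear: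
  "open U \<Longrightarrow> bounded_bilinear B \<Longrightarrow> msmooth_on A U f \<Longrightarrow> msmooth_on A U g \<Longrightarrow>
   msmooth_on A U (\<lambda>p. B (f p) (g p))"
  unfolding msmooth_on_def o_def using open_image smooth_on_bilinear by blast

lemma msmooth_on_add:
  "open U \<Longrightarrow> msmooth_on A U f \<Longrightarrow> msmooth_on A U g \<Longrightarrow> msmooth_on A U (\<lambda>p. f p + g p)"
  unfolding msmooth_on_def o_def using open_image smooth_on_add by blast

lemma msmooth_on_sum:
  "open U \<Longrightarrow> (\<And>i. i \<in> I \<Longrightarrow> msmooth_on A U (f i)) \<Longrightarrow> msmooth_on A U (\<lambda>p. \<Sum>i\<in>I. f i p)"
  by (induction I rule: infinite_finite_induct) (auto intro: msmooth_on_const msmooth_on_add)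

lemmas msmooth_on_mult = msmooth_on_bilinear[OF _ bounded_bilinear_mult]
lemmas msmooth_on_scaleR = msmooth_on_bilinear[OF _ bounded_bilinear_scaleR]

lemma msmooth_on_cmult: "open U \<Longrightarrow> msmooth_on A U f \<Longrightarrow> msmooth_on A U (\<lambda>p. k * f p :: real)"
  by (intro msmooth_on_mult msmooth_on_const)

lemma msmooth_on_diff:
  fixes f h :: "'a \<Rightarrow> real"
  assumes "open U" "msmooth_on A U f" "msmooth_on A U h"
  shows "msmooth_on A U (\<lambda>p. f p - h p)"
  using msmooth_on_add[OF assms(1,2) msmooth_on_cmult[OF assms(1,3), of "-1"]] by simp

lemma msmooth_on_compose:
  fixes f :: "'a \<Rightarrow> 'b::euclidean_space"
  assumes "open U" "open T" "f ` U \<subseteq> T" "msmooth_on A U f" "smooth_on T h"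
  shows "msmooth_on A U (\<lambda>p. h (f p))"
  unfolding msmooth_on_def
proof
  fix c assume c: "c \<in> A"
  have "(f \<circ> chart_inv c) ` snd c ` (fst c \<inter> U) \<subseteq> T"
    using assms(3) chart_inv_chart[OF c] by auto
  from smooth_on_compose[OF open_image[OF c assms(1)] assms(2) this msmooth_onD[OF assms(4) c] assms(5)]
  show "smooth_on (snd c ` (fst c \<inter> U)) ((\<lambda>p. h (f p)) \<circ> chart_inv c)" by (simp add: o_def)
qed

lemma msmooth_on_chart: "c \<in> A \<Longrightarrow> msmooth_on A (fst c) (snd c)"
  unfolding msmooth_on_def using smooth_transition by blast

text \<open>Tangent vectors are differentiated in the preferred chart at their base point; by the chain
  rule any other chart around that point gives the same result.\<close>

lemma mderiv_chart:
  assumes "open U" "p \<in> U" "msmooth_on A U f" "c \<in> A" "p \<in> fst c"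
  shows "mderiv A f p v = dderiv (f \<circ> chart_inv c) (snd c p) (mderiv A (snd c) p v)"
    and "((f \<circ> chart_inv c) has_derivative dderiv (f \<circ> chart_inv c) (snd c p)) (at (snd c p))"
    and "((f \<circ> chart_inv (chart_at A p)) has_derivative mderiv A f p) (at (snd (chart_at A p) p))"
    and "mderiv A f p (coord_field A c v p) = dderiv (f \<circ> chart_inv c) (snd c p) v"
proof -
  have gen: "((f \<circ> chart_inv c) has_derivative dderiv (f \<circ> chart_inv c) (snd c p)) (at (snd c p))"
    if "c \<in> A" "p \<in> fst c" for c
    using smooth_on_has_derivative[OF msmooth_onD[OF assms(3) that(1)]] that assms(2) by blast
  have chain: "dderiv (f \<circ> chart_inv c) (snd c p) v =
      dderiv (f \<circ> chart_inv d) (snd d p) (dderiv (snd d \<circ> chart_inv c) (snd c p) v)"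
    if c: "c \<in> A" "p \<in> fst c" and d: "d \<in> A" "p \<in> fst d" for c d v
  proof -
    let ?S = "snd c ` (fst c \<inter> fst d)"
    have S: "open ?S" "snd c p \<in> ?S" using open_image c d open_dom by auto
    have eq: "\<And>x. x \<in> ?S \<Longrightarrow> (f \<circ> chart_inv c) x = (f \<circ> chart_inv d) ((snd d \<circ> chart_inv c) x)"
      using chart_chart_inv[OF c(1)] chart_inv_chart[OF d(1)] by simp
    have p: "snd d p = (snd d \<circ> chart_inv c) (snd c p)" using chart_inv_chart[OF c] by simp
    have 1: "((snd d \<circ> chart_inv c) has_derivative dderiv (snd d \<circ> chart_inv c) (snd c p)) (at (snd c p))"
      using smooth_on_has_derivative[OF smooth_transition[OF c(1) d(1)] S(2)] .
    have 2: "((\<lambda>x. (f \<circ> chart_inv d) ((snd d \<circ> chart_inv c) x)) has_derivative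
        (\<lambda>v. dderiv (f \<circ> chart_inv d) (snd d p) (dderiv (snd d \<circ> chart_inv c) (snd c p) v))) (at (snd c p))"
      using has_derivative_compose[OF 1] gen[OF d] unfolding p by blast
    have "((f \<circ> chart_inv c) has_derivative
        (\<lambda>v. dderiv (f \<circ> chart_inv d) (snd d p) (dderiv (snd d \<circ> chart_inv c) (snd c p) v))) (at (snd c p))"
      by (rule iffD2[OF dderiv_cong(1)[OF S eq] 2])
    then show ?thesis by (rule dderiv_eq)
  qed
  show "mderiv A f p v = dderiv (f \<circ> chart_inv c) (snd c p) (mderiv A (snd c) p v)"
    unfolding mderiv_def using chain[OF chart_at assms(4,5)] .
  show "((f \<circ> chart_inv c) has_derivative dderiv (f \<circ> chart_inv c) (snd c p)) (at (snd c p))"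
    using gen assms(4,5) .
  show "((f \<circ> chart_inv (chart_at A p)) has_derivative mderiv A f p) (at (snd (chart_at A p) p))"
    using gen[OF chart_at] unfolding mderiv_def .
  show "mderiv A f p (coord_field A c v p) = dderiv (f \<circ> chart_inv c) (snd c p) v"
    unfolding mderiv_def coord_field_def using chain[OF assms(4,5) chart_at] by simp
qed

lemma linear_mderiv:
  "open U \<Longrightarrow> p \<in> U \<Longrightarrow> msmooth_on A U f \<Longrightarrow> linear (mderiv A f p)"
  using mderiv_chart(3)[OF _ _ _ chart_at] has_derivative_linear by blast

lemma linear_components: "c \<in> A \<Longrightarrow> p \<in> fst c \<Longrightarrow> linear (mderiv A (snd c) p)"
  using linear_mderiv[OF open_dom _ msmooth_on_chart] by blast

lemma dderiv_chart_chart_inv: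
  assumes "c \<in> A" "p \<in> fst c"
  shows "dderiv (snd c \<circ> chart_inv c) (snd c p) u = u"
proof -
  have "frechet_derivative (snd c \<circ> chart_inv c) (at (snd c p)) = frechet_derivative (\<lambda>x. x) (at (snd c p))"
    by (rule dderiv_cong(2)[OF open_range[OF assms(1)]])
      (use assms(2) chart_inv_chart[OF assms(1)] in auto)
  then show ?thesis by simp
qed

lemma components_coord_field:
  assumes "c \<in> A" "p \<in> fst c"
  shows "mderiv A (snd c) p (coord_field A c u p) = u"
  using mderiv_chart(4)[OF open_dom[OF assms(1)] assms(2) msmooth_on_chart[OF assms(1)] assms]
    dderiv_chart_chart_inv[OF assms] by simp

lemma linear_coord_field:
  assumes "c \<in> A" "p \<in> fst c"
  shows "linear (\<lambda>u. coord_field A c u p)"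
proof -
  let ?d = "chart_at A p"
  have "((snd ?d \<circ> chart_inv c) has_derivative dderiv (snd ?d \<circ> chart_inv c) (snd c p)) (at (snd c p))"
    by (rule smooth_on_has_derivative[OF smooth_transition]) (use assms chart_at in auto)
  then show ?thesis unfolding coord_field_def by (rule has_derivative_linear)
qed

lemma coord_field_components:
  assumes "c \<in> A" "p \<in> fst c"
  shows "coord_field A c (mderiv A (snd c) p v) p = v"
  using linear_inverse_left[OF linear_components[OF assms] linear_coord_field[OF assms]]
    components_coord_field[OF assms] by (auto simp: fun_eq_iff)

lemma mderiv_chart_at [simp]: "mderiv A (snd (chart_at A p)) p v = v"
  unfolding mderiv_def using dderiv_chart_chart_inv[OF chart_at] .

lemma coord_field_chart_at [simp]: "coord_field A (chart_at A p) v p = v"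
  using coord_field_components[OF chart_at, of p v] by simp

lemma msmooth_on_dderiv:
  assumes "c \<in> A" "open U" "U \<subseteq> fst c" "msmooth_on A U f" "msmooth_on A U V"
  shows "msmooth_on A U (\<lambda>q. dderiv (f \<circ> chart_inv c) (snd c q) (V q))"
proof -
  have o: "open (snd c ` U)" by (rule open_image'[OF assms(1-3)])
  have f: "smooth_on (snd c ` U) (f \<circ> chart_inv c)" and V: "smooth_on (snd c ` U) (V \<circ> chart_inv c)"
    using msmooth_on_chart_iff[OF assms(1-3)] assms(4,5) by auto
  have "smooth_on (snd c ` U) (\<lambda>x. \<Sum>b\<in>Basis. ((V \<circ> chart_inv c) x \<bullet> b) *\<^sub>R dderiv (f \<circ> chart_inv c) x b)"
    by (intro smooth_on_sum o smooth_on_bilinear[OF o bounded_bilinear_scaleR]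
        smooth_on_bilinear[OF o bounded_bilinear_inner] V smooth_on_const smooth_on_dderiv f)
  moreover have "(\<Sum>b\<in>Basis. ((V \<circ> chart_inv c) x \<bullet> b) *\<^sub>R dderiv (f \<circ> chart_inv c) x b) =
      ((\<lambda>q. dderiv (f \<circ> chart_inv c) (snd c q) (V q)) \<circ> chart_inv c) x" if "x \<in> snd c ` U" for x
  proof -
    have "snd c (chart_inv c x) = x" using that assms(3) chart_inv_chart[OF assms(1)] by auto
    then show ?thesis
      using linear_eq_sum_Basis[OF has_derivative_linear[OF smooth_on_has_derivative[OF f that]],
          of "V (chart_inv c x)"] by simp
  qed
  ultimately show ?thesis
    unfolding msmooth_on_chart_iff[OF assms(1-3)] using smooth_on_cong[OF o] by (metis (no_types, lifting))
qed

lemma smooth_vf_chart_iff: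
  assumes "c \<in> A" "open U" "U \<subseteq> fst c"
  shows "smooth_vf A U X \<longleftrightarrow> msmooth_on A U (\<lambda>q. mderiv A (snd c) q (X q))"
proof
  assume "smooth_vf A U X"
  then show "msmooth_on A U (\<lambda>q. mderiv A (snd c) q (X q))"
    using assms unfolding smooth_vf_def by (metis inf.absorb2)
next
  assume m: "msmooth_on A U (\<lambda>q. mderiv A (snd c) q (X q))"
  show "smooth_vf A U X" unfolding smooth_vf_def
  proof
    fix d assume d: "d \<in> A"
    let ?U = "fst d \<inter> U"
    have U: "open ?U" "?U \<subseteq> fst c" "?U \<subseteq> U" "?U \<subseteq> fst d" using assms open_dom[OF d] by auto
    have "msmooth_on A ?U (\<lambda>q. dderiv (snd d \<circ> chart_inv c) (snd c q) (mderiv A (snd c) q (X q)))"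
      by (rule msmooth_on_dderiv[OF assms(1) U(1,2) msmooth_on_subset[OF msmooth_on_chart[OF d] U(4)]
            msmooth_on_subset[OF m U(3)]])
    moreover have "dderiv (snd d \<circ> chart_inv c) (snd c q) (mderiv A (snd c) q (X q)) = mderiv A (snd d) q (X q)"
      if "q \<in> ?U" for q
      by (rule mderiv_chart(1)[OF open_dom[OF d] _ msmooth_on_chart[OF d] assms(1), symmetric])
        (use U that in auto)
    ultimately show "msmooth_on A ?U (\<lambda>q. mderiv A (snd d) q (X q))"
      using msmooth_on_cong[OF U(1)] by (metis (no_types, lifting))
  qed
qed

lemma smooth_vf_components:
  "smooth_vf A U X \<Longrightarrow> c \<in> A \<Longrightarrow> msmooth_on A (fst c \<inter> U) (\<lambda>q. mderiv A (snd c) q (X q))"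
  unfolding smooth_vf_def by blast

lemma smooth_vf_subset: "smooth_vf A U X \<Longrightarrow> V \<subseteq> U \<Longrightarrow> smooth_vf A V X"
  unfolding smooth_vf_def using msmooth_on_subset by (meson Int_mono subset_refl)

lemma smooth_vf_cong:
  assumes "open U" "\<And>p. p \<in> U \<Longrightarrow> X p = Y p"
  shows "smooth_vf A U X \<longleftrightarrow> smooth_vf A U Y"
  unfolding smooth_vf_def
proof (rule ball_cong[OF refl])
  fix c assume "c \<in> A"
  then have "open (fst c \<inter> U)" using open_dom assms(1) by (intro open_Int)
  then show "msmooth_on A (fst c \<inter> U) (\<lambda>p. mderiv A (snd c) p (X p)) \<longleftrightarrow>
      msmooth_on A (fst c \<inter> U) (\<lambda>p. mderiv A (snd c) p (Y p))"
    by (rule msmooth_on_cong) (simp add: assms(2))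
qed

lemma smooth_vf_add:
  assumes "open U" "smooth_vf A U X" "smooth_vf A U Y"
  shows "smooth_vf A U (\<lambda>q. X q + Y q)"
  unfolding smooth_vf_def
proof
  fix c assume c: "c \<in> A"
  have o: "open (fst c \<inter> U)" using open_dom[OF c] assms(1) by (rule open_Int)
  have "msmooth_on A (fst c \<inter> U) (\<lambda>q. mderiv A (snd c) q (X q) + mderiv A (snd c) q (Y q))"
    by (intro msmooth_on_add o smooth_vf_components[OF _ c] assms)
  then show "msmooth_on A (fst c \<inter> U) (\<lambda>q. mderiv A (snd c) q (X q + Y q))"
    by (subst msmooth_on_cong[OF o]) (auto simp: linear_add[OF linear_components[OF c]])
qed

lemma smooth_vf_scaleR:
  assumes "open U" "msmooth_on A U f" "smooth_vf A U X"
  shows "smooth_vf A U (\<lambda>q. f q *\<^sub>R X q)"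
  unfolding smooth_vf_def
proof
  fix c assume c: "c \<in> A"
  have o: "open (fst c \<inter> U)" using open_dom[OF c] assms(1) by (rule open_Int)
  have "msmooth_on A (fst c \<inter> U) (\<lambda>q. f q *\<^sub>R mderiv A (snd c) q (X q))"
    by (intro msmooth_on_scaleR o smooth_vf_components[OF _ c] assms msmooth_on_subset[OF assms(2)]) auto
  then show "msmooth_on A (fst c \<inter> U) (\<lambda>q. mderiv A (snd c) q (f q *\<^sub>R X q))"
    by (subst msmooth_on_cong[OF o]) (auto simp: linear_cmul[OF linear_components[OF c]])
qed

lemma smooth_vf_zero: "open U \<Longrightarrow> smooth_vf A U (\<lambda>q. 0)"
proof -
  assume U: "open U"
  have "msmooth_on A (fst c \<inter> U) (\<lambda>q. mderiv A (snd c) q 0)" if "c \<in> A" for c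
  proof -
    have o: "open (fst c \<inter> U)" using open_dom[OF that] U by (rule open_Int)
    show ?thesis
      by (subst msmooth_on_cong[OF o, where g = "\<lambda>_. 0"])
        (auto simp: linear_0[OF linear_components[OF that]] msmooth_on_const o)
  qed
  then show ?thesis unfolding smooth_vf_def by blast
qed

lemma smooth_vf_sum:
  "open U \<Longrightarrow> (\<And>i. i \<in> I \<Longrightarrow> smooth_vf A U (X i)) \<Longrightarrow> smooth_vf A U (\<lambda>q. \<Sum>i\<in>I. X i q)"
  by (induction I rule: infinite_finite_induct) (auto intro: smooth_vf_zero smooth_vf_add)

lemma smooth_vf_coord_field:
  assumes "c \<in> A"
  shows "smooth_vf A (fst c) (coord_field A c u)"
proof -
  have "msmooth_on A (fst c) (\<lambda>q. mderiv A (snd c) q (coord_field A c u q))"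
    by (subst msmooth_on_cong[OF open_dom[OF assms], where g = "\<lambda>_. u"])
      (auto simp: components_coord_field[OF assms] msmooth_on_const open_dom[OF assms])
  then show ?thesis using smooth_vf_chart_iff[OF assms open_dom[OF assms]] by blast
qed

lemma msmooth_on_mderiv:
  assumes "open U" "msmooth_on A U f" "smooth_vf A U X"
  shows "msmooth_on A U (\<lambda>q. mderiv A f q (X q))"
proof (rule msmooth_on_local[OF assms(1)])
  fix p assume p: "p \<in> U"
  let ?c = "chart_at A p"
  let ?U = "U \<inter> fst ?c"
  have o: "open ?U" using assms(1) open_dom[OF chart_at(1)] by auto
  have "msmooth_on A ?U (\<lambda>q. dderiv (f \<circ> chart_inv ?c) (snd ?c q) (mderiv A (snd ?c) q (X q)))"
    by (rule msmooth_on_dderiv[OF chart_at(1) o _ msmooth_on_subset[OF assms(2)]])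
      (use smooth_vf_components[OF assms(3) chart_at(1)] in \<open>auto simp: Int_commute\<close>)
  moreover have "dderiv (f \<circ> chart_inv ?c) (snd ?c q) (mderiv A (snd ?c) q (X q)) = mderiv A f q (X q)"
    if "q \<in> ?U" for q
    by (rule mderiv_chart(1)[OF assms(1) _ assms(2) chart_at(1), symmetric]) (use that in auto)
  ultimately have "msmooth_on A ?U (\<lambda>q. mderiv A f q (X q))"
    using msmooth_on_cong[OF o] by (metis (no_types, lifting))
  then show "\<exists>V. open V \<and> p \<in> V \<and> msmooth_on A (U \<inter> V) (\<lambda>q. mderiv A f q (X q))"
    using open_dom[OF chart_at(1)] chart_at(2) by blast
qed

lemma mderiv_cong:
  assumes "open U" "p \<in> U" "\<And>q. q \<in> U \<Longrightarrow> f q = h q"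
  shows "mderiv A f p v = mderiv A h p v"
proof -
  let ?c = "chart_at A p"
  have "frechet_derivative (f \<circ> chart_inv ?c) (at (snd ?c p)) = frechet_derivative (h \<circ> chart_inv ?c) (at (snd ?c p))"
  proof (rule dderiv_cong(2)[OF open_image[OF chart_at(1) assms(1)]])
    show "snd ?c p \<in> snd ?c ` (fst ?c \<inter> U)" using chart_at(2) assms(2) by blast
    show "(f \<circ> chart_inv ?c) x = (h \<circ> chart_inv ?c) x" if "x \<in> snd ?c ` (fst ?c \<inter> U)" for x
      using chart_chart_inv(2)[OF chart_at(1) that] assms(3) by simp
  qed
  then show ?thesis by (simp add: mderiv_def)
qed

lemma exists_local_ext:
  "local_ext A p v p = v" "\<exists>U. open U \<and> p \<in> U \<and> smooth_vf A U (local_ext A p v)"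
proof -
  have "\<exists>X. X p = v \<and> (\<exists>U. open U \<and> p \<in> U \<and> smooth_vf A U X)"
    using smooth_vf_coord_field[OF chart_at(1), of p v] open_dom[OF chart_at(1)] chart_at(2)
      coord_field_chart_at by blast
  from someI_ex[OF this]
  show "local_ext A p v p = v" "\<exists>U. open U \<and> p \<in> U \<and> smooth_vf A U (local_ext A p v)"
    unfolding local_ext_def by auto
qed

end

section \<open>Orthonormal frames\<close>

locale riemannian_manifold = smooth_atlas A
  for A :: "('a::{t2_space,second_countable_topology}, 'e::euclidean_space) atlas" +
  fixes g :: "('a, 'e) form2"
  assumes metric: "riemannian_metric A g"
begin

lemma g_linear: "linear (g p u)" "linear (\<lambda>u. g p u v)"
  using metric unfolding riemannian_metric_def bilinear_def by blast+

lemmas g_simps =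
  linear_add[OF g_linear(1)] linear_add[OF g_linear(2)]
  linear_diff[OF g_linear(1)] linear_diff[OF g_linear(2)]
  linear_cmul[OF g_linear(1)] linear_cmul[OF g_linear(2)]
  linear_0[OF g_linear(1)] linear_0[OF g_linear(2)]
  linear_neg[OF g_linear(1)] linear_neg[OF g_linear(2)]
  linear_sum[OF g_linear(1)] linear_sum[OF g_linear(2)]

lemma g_commute: "g p u v = g p v u"
  using metric unfolding riemannian_metric_def by blast

lemma g_pos: "u \<noteq> 0 \<Longrightarrow> g p u u > 0"
  using metric unfolding riemannian_metric_def by blast

lemma g_nonneg: "g p u u \<ge> 0"
  using g_pos[of u p] by (cases "u = 0") (auto simp: g_simps)

lemma g_eq_0_iff: "g p u u = 0 \<longleftrightarrow> u = 0"
  using g_pos[of u p] by (cases "u = 0") (auto simp: g_simps)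

lemma msmooth_on_g:
  "open U \<Longrightarrow> smooth_vf A U X \<Longrightarrow> smooth_vf A U Y \<Longrightarrow> msmooth_on A U (\<lambda>p. g p (X p) (Y p))"
  using metric unfolding riemannian_metric_def by blast

definition orthonormal :: "'a \<Rightarrow> (nat \<Rightarrow> 'e) \<Rightarrow> nat \<Rightarrow> bool" where
  "orthonormal p e k \<longleftrightarrow> (\<forall>i<k. \<forall>j<k. g p (e i) (e j) = (if i = j then 1 else 0))"

lemma orthonormal_expansion:
  assumes "orthonormal p e (DIM('e))"
  shows "u = (\<Sum>i<DIM('e). g p u (e i) *\<^sub>R e i)"
proof -
  let ?n = "DIM('e)"
  obtain f where f: "bij_betw f {..<?n} (Basis :: 'e set)"
    using ex_bij_betw_nat_finite[of "Basis :: 'e set"] by (auto simp: atLeast0LessThan)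
  have on: "g p (\<Sum>i<?n. a i *\<^sub>R e i) (e j) = a j" if "j < ?n" for a j
  proof -
    have "g p (\<Sum>i<?n. a i *\<^sub>R e i) (e j) = (\<Sum>i<?n. a i * (if i = j then 1 else 0))"
      using assms that by (simp add: g_simps orthonormal_def)
    also have "\<dots> = a j" using that by (simp add: if_distrib cong: if_cong)
    finally show ?thesis .
  qed
  define L where "L x = (\<Sum>i<?n. (x \<bullet> f i) *\<^sub>R e i)" for x :: 'e
  have "linear L" unfolding L_def
    by (intro linearI) (simp_all add: inner_add_left scaleR_add_left sum.distrib scaleR_sum_right)
  moreover have "inj L" unfolding linear_injective_0[OF \<open>linear L\<close>]
  proof (intro allI impI)
    fix x assume "L x = 0"
    then have 0: "x \<bullet> f j = 0" if "j < ?n" for j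
      using on[OF that, of "\<lambda>i. x \<bullet> f i"] by (simp add: L_def g_simps)
    have "x \<bullet> b = 0" if b: "b \<in> Basis" for b
    proof -
      have "b \<in> f ` {..<?n}" using f b unfolding bij_betw_def by simp
      then obtain j where "j < ?n" "b = f j" by auto
      then show ?thesis using 0 by simp
    qed
    then show "x = 0" using euclidean_all_zero_iff by blast
  qed
  \<comment> \<open>Equality of dimensions: \<open>DIM('e)\<close> independent vectors span the space.\<close>
  ultimately have "surj L" using linear_injective_imp_surjective by blast
  then obtain x where "u = L x" by (metis surjD)
  then show ?thesis using on[of _ "\<lambda>i. x \<bullet> f i"] by (simp add: L_def)
qed

text \<open>The Gram-Schmidt process, applied to the coordinate fields of a chart: as the new field is
  normalised by the smooth function \<open>1 / sqrt\<close> of its positive squared norm, it stays smooth. The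
  condition on the spans makes the next coordinate field independent of the fields constructed so
  far.\<close>

lemma gram_schmidt:
  assumes c: "c \<in> A" and f: "bij_betw f {..<DIM('e)} (Basis :: 'e set)" and "k \<le> DIM('e)"
  shows "\<exists>E. (\<forall>i<k. smooth_vf A (fst c) (E i)) \<and> (\<forall>q\<in>fst c. orthonormal q (\<lambda>i. E i q) k) \<and>
    (\<forall>q\<in>fst c. \<forall>i<k. E i q \<in> span ((\<lambda>j. coord_field A c (f j) q) ` {..<k}))"
  using assms(3)
proof (induction k)
  case 0
  then show ?case by (auto simp: orthonormal_def)
next
  case (Suc k)
  obtain E where "\<forall>i<k. smooth_vf A (fst c) (E i)" "\<forall>q\<in>fst c. orthonormal q (\<lambda>i. E i q) k"
    "\<forall>q\<in>fst c. \<forall>i<k. E i q \<in> span ((\<lambda>j. coord_field A c (f j) q) ` {..<k})"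
    using Suc.IH[OF Suc_leD[OF Suc.prems]] by (elim exE conjE)
  then have E: "\<And>i. i < k \<Longrightarrow> smooth_vf A (fst c) (E i)"
    and on: "\<And>q i j. q \<in> fst c \<Longrightarrow> i < k \<Longrightarrow> j < k \<Longrightarrow> g q (E i q) (E j q) = (if i = j then 1 else 0)"
    and sp: "\<And>q i. q \<in> fst c \<Longrightarrow> i < k \<Longrightarrow> E i q \<in> span ((\<lambda>j. coord_field A c (f j) q) ` {..<k})"
    unfolding orthonormal_def by auto
  define K where "K q = coord_field A c (f k) q" for q
  define W where "W q = K q + (-1) *\<^sub>R (\<Sum>i<k. g q (K q) (E i q) *\<^sub>R E i q)" for q
  define N where "N q = inverse (sqrt (g q (W q) (W q)))" for q
  define F where "F = E(k := (\<lambda>q. N q *\<^sub>R W q))"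
  have oc: "open (fst c)" using open_dom[OF c] .
  have K: "smooth_vf A (fst c) K" unfolding K_def[abs_def] using smooth_vf_coord_field[OF c] .
  have W: "smooth_vf A (fst c) W" unfolding W_def[abs_def]
    by (intro smooth_vf_add smooth_vf_scaleR smooth_vf_sum msmooth_on_g msmooth_on_const oc K E) auto
  have span_Suc: "span ((\<lambda>j. coord_field A c (f j) q) ` {..<k}) \<subseteq>
      span ((\<lambda>j. coord_field A c (f j) q) ` {..<Suc k})" for q
    by (intro span_mono image_mono) auto
  have Esum: "(\<Sum>i<k. g q (K q) (E i q) *\<^sub>R E i q) \<in> span ((\<lambda>j. coord_field A c (f j) q) ` {..<k})"
    if "q \<in> fst c" for q
    by (intro span_sum span_scale) (use sp[OF that] in auto)
  have W0: "W q \<noteq> 0" if q: "q \<in> fst c" for q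
  proof
    let ?L = "\<lambda>u. coord_field A c u q"
    assume "W q = 0"
    then have "?L (f k) \<in> span ((\<lambda>j. ?L (f j)) ` {..<k})"
      using Esum[OF q] by (simp add: W_def K_def)
    also have "(\<lambda>j. ?L (f j)) ` {..<k} = ?L ` f ` {..<k}" by auto
    also have "span (?L ` f ` {..<k}) = ?L ` span (f ` {..<k})"
      using linear_span_image[OF linear_coord_field[OF c q]] .
    finally obtain s where s: "s \<in> span (f ` {..<k})" "?L (f k) = ?L s" by auto
    then have "f k \<in> span (f ` {..<k})" using components_coord_field[OF c q] by metis
    moreover have "f ` {..<k} \<subseteq> Basis - {f k}"
      using f Suc.prems unfolding bij_betw_def inj_on_def by fastforce
    ultimately have "f k \<in> span (Basis - {f k})" using span_mono by blast
    moreover have "f k \<in> Basis" using f Suc.prems by (auto simp: bij_betw_def)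
    ultimately show False using independent_Basis unfolding dependent_def by blast
  qed
  have pos: "g q (W q) (W q) > 0" if "q \<in> fst c" for q using g_pos[OF W0[OF that]] .
  have "msmooth_on A (fst c) N" unfolding N_def[abs_def]
    by (rule msmooth_on_compose[OF oc _ _ msmooth_on_g[OF oc W W] smooth_on_inverse_sqrt]) (use pos in auto)
  then have NW: "smooth_vf A (fst c) (\<lambda>q. N q *\<^sub>R W q)" by (rule smooth_vf_scaleR[OF oc _ W])
  have N2: "N q * (N q * g q (W q) (W q)) = 1" if "q \<in> fst c" for q
    using pos[OF that] by (simp add: N_def field_simps)
  have WE: "g q (W q) (E j q) = 0" if q: "q \<in> fst c" and j: "j < k" for q j
  proof -
    have "g q (\<Sum>i<k. g q (K q) (E i q) *\<^sub>R E i q) (E j q) =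
        (\<Sum>i<k. g q (K q) (E i q) * (if i = j then 1 else 0))"
      using on[OF q _ j] by (simp add: g_simps)
    also have "\<dots> = g q (K q) (E j q)" using j by (simp add: if_distrib cong: if_cong)
    finally show ?thesis by (simp add: W_def g_simps)
  qed
  have "smooth_vf A (fst c) (F i)" if "i < Suc k" for i
    using that E NW by (auto simp: F_def less_Suc_eq)
  moreover have "g q (F i q) (F j q) = (if i = j then 1 else 0)"
    if q: "q \<in> fst c" and ij: "i < Suc k" "j < Suc k" for q i j
    using on[OF q, of i j] N2[OF q] WE[OF q] ij
    by (auto simp: F_def less_Suc_eq g_simps g_commute[of q "E i q" "W q"])
  moreover have "F i q \<in> span ((\<lambda>j. coord_field A c (f j) q) ` {..<Suc k})"
    if q: "q \<in> fst c" and i: "i < Suc k" for q i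
  proof (cases "i = k")
    case True
    have "K q \<in> span ((\<lambda>j. coord_field A c (f j) q) ` {..<Suc k})"
      unfolding K_def by (rule span_base) auto
    then have "W q \<in> span ((\<lambda>j. coord_field A c (f j) q) ` {..<Suc k})"
      unfolding W_def using Esum[OF q] span_Suc by (intro span_add span_scale) auto
    then show ?thesis unfolding F_def True by (simp add: span_scale)
  next
    case False
    then show ?thesis using sp[OF q, of i] span_Suc[of q] i by (auto simp: F_def)
  qed
  ultimately show ?case unfolding orthonormal_def by blast
qed

lemma local_orthonormal_frame_exists: "\<exists>E. local_orthonormal_frame A g p E"
proof -
  obtain f where f: "bij_betw f {..<DIM('e)} (Basis :: 'e set)"
    using ex_bij_betw_nat_finite[of "Basis :: 'e set"] by (auto simp: atLeast0LessThan)
  let ?c = "chart_at A p"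
  from gram_schmidt[OF chart_at(1)[of p] f order_refl] obtain E
    where "\<forall>i<DIM('e). smooth_vf A (fst ?c) (E i)"
      and "\<forall>q\<in>fst ?c. orthonormal q (\<lambda>i. E i q) (DIM('e))" by (elim exE conjE)
  then have "local_orthonormal_frame A g p E"
    unfolding local_orthonormal_frame_def orthonormal_def
    using open_dom[OF chart_at(1)] chart_at(2) by (intro exI[of _ "fst ?c"]) simp
  then show ?thesis by (intro exI[of _ E])
qed

lemma some_frame: "local_orthonormal_frame A g p (some_frame A g p)"
  unfolding some_frame_def using someI_ex[OF local_orthonormal_frame_exists] .

end

text \<open>Orthogonal projection to a subspace, for an inner product other than the standard one. A basis
  of the subspace is added vector by vector; the new vector \<open>a\<close> contributes the projection to the
  part of \<open>a\<close> that is orthogonal to its predecessors.\<close>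

lemma orthogonal_decomposition:
  fixes b :: "'e::euclidean_space \<Rightarrow> 'e \<Rightarrow> real"
  assumes "bilinear b" "\<And>u v. b u v = b v u" "\<And>u. u \<noteq> 0 \<Longrightarrow> b u u > 0" "subspace S"
  obtains k where "k \<in> S" "\<And>w. w \<in> S \<Longrightarrow> b (v - k) w = 0"
proof -
  have lin: "linear (b u)" "linear (\<lambda>u. b u w)" for u w
    using assms(1) unfolding bilinear_def by blast+
  note simps = linear_add[OF lin(1)] linear_add[OF lin(2)] linear_diff[OF lin(1)] linear_diff[OF lin(2)]
    linear_cmul[OF lin(1)] linear_cmul[OF lin(2)] linear_0[OF lin(1)] linear_0[OF lin(2)]
  have perp_span: "b u w = 0" if "w \<in> span B" "\<And>x. x \<in> B \<Longrightarrow> b u x = 0" for u w B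
    using that(1) by (induction rule: span_induct_alt) (auto simp: simps that(2))
  have "\<exists>k\<in>span B. \<forall>w\<in>B. b (v - k) w = 0" if "finite B" for B and v
    using that
  proof (induction B arbitrary: v)
    case empty
    then show ?case by auto
  next
    case (insert a B)
    obtain ka where ka: "ka \<in> span B" "\<And>w. w \<in> B \<Longrightarrow> b (a - ka) w = 0" using insert.IH by blast
    obtain kv where kv: "kv \<in> span B" "\<And>w. w \<in> B \<Longrightarrow> b (v - kv) w = 0" using insert.IH by blast
    define t where "t = b (v - kv) (a - ka) / b (a - ka) (a - ka)"
    \<comment> \<open>If \<open>a = ka\<close>, then \<open>t = 0\<close> by division by zero, and both sides vanish.\<close>
    have t: "t * b (a - ka) (a - ka) = b (v - kv) (a - ka)"
      using assms(3)[of "a - ka"] by (cases "a - ka = 0") (auto simp: t_def simps(7,8))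
    have "kv + t *\<^sub>R (a - ka) \<in> span (insert a B)"
      using ka(1) kv(1) span_mono[OF subset_insertI[of B a]]
      by (intro span_add span_scale span_diff) (auto intro: span_base)
    moreover have B0: "b (v - (kv + t *\<^sub>R (a - ka))) w = 0" if "w \<in> B" for w
    proof -
      have "b (v - (kv + t *\<^sub>R (a - ka))) w = b (v - kv) w - t * b (a - ka) w"
        using simps(4)[of "v - kv" "t *\<^sub>R (a - ka)" w] simps(6)[of t "a - ka" w]
        by (simp add: diff_diff_eq)
      then show ?thesis using ka(2) kv(2) that by simp
    qed
    moreover have "b (v - (kv + t *\<^sub>R (a - ka))) a = 0"
    proof -
      let ?z = "v - (kv + t *\<^sub>R (a - ka))"
      have "b ?z (a - ka) = b (v - kv) (a - ka) - t * b (a - ka) (a - ka)"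
        using simps(4)[of "v - kv" "t *\<^sub>R (a - ka)" "a - ka"] simps(6)[of t "a - ka" "a - ka"]
        by (simp add: diff_diff_eq)
      then have "b ?z (a - ka) = 0" using t by simp
      moreover have "b ?z ka = 0" using perp_span[OF ka(1) B0] .
      moreover have "b ?z a = b ?z (a - ka) + b ?z ka" using simps(1)[of ?z "a - ka" ka] by simp
      ultimately show ?thesis by simp
    qed
    ultimately show ?case by blast
  qed
  moreover obtain B where "finite B" "span B = S"
    using basis_exists[of S] assms(4)
    by (metis finiteI_independent span_eq_iff span_mono span_span subset_antisym)
  ultimately obtain k where "k \<in> S" "\<And>w. w \<in> B \<Longrightarrow> b (v - k) w = 0" by blast
  then show ?thesis using that perp_span \<open>span B = S\<close> by metis
qed

section \<open>The exterior derivative of a 2-form in coordinates\<close>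

definition smooth_bilinear ::
  "('a::topological_space, 'e::euclidean_space) atlas \<Rightarrow> ('a, 'e) form2 \<Rightarrow> bool" where
  "smooth_bilinear A F \<longleftrightarrow> (\<forall>p. bilinear (F p)) \<and>
     (\<forall>U X Y. open U \<longrightarrow> smooth_vf A U X \<longrightarrow> smooth_vf A U Y \<longrightarrow> msmooth_on A U (\<lambda>p. F p (X p) (Y p)))"

definition alternating :: "('a, 'e) form2 \<Rightarrow> bool" where
  "alternating F \<longleftrightarrow> (\<forall>p u v. F p u v = - F p v u)"

lemma alternatingD: "alternating F \<Longrightarrow> F p u v = - F p v u"
  unfolding alternating_def by blast

lemma bilinear_expansion:
  fixes b :: "'e::euclidean_space \<Rightarrow> 'e \<Rightarrow> real"
  assumes "bilinear b"
  shows "b x y = (\<Sum>i\<in>Basis. \<Sum>j\<in>Basis. (x \<bullet> i) * (y \<bullet> j) * b i j)"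
proof -
  have 1: "linear (\<lambda>x. b x y)" for y using assms unfolding bilinear_def by blast
  have 2: "linear (b x)" for x using assms unfolding bilinear_def by blast
  have "b x y = (\<Sum>i\<in>Basis. (x \<bullet> i) *\<^sub>R b i y)" using linear_eq_sum_Basis[OF 1] .
  also have "\<dots> = (\<Sum>i\<in>Basis. (x \<bullet> i) *\<^sub>R (\<Sum>j\<in>Basis. (y \<bullet> j) *\<^sub>R b i j))"
    using linear_eq_sum_Basis[OF 2, of _ y] by simp
  finally show ?thesis by (simp add: sum_distrib_left mult.assoc)
qed

text \<open>The product rule for \<open>y \<mapsto> F\<^bsub>f y\<^esub>(V y, W y)\<close>, where the bilinear forms \<open>F\<close> have components \<open>G\<close>.
  With \<open>f\<close> the identity it differentiates a form on two fields, with \<open>f\<close> a map in charts the pullback of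
  a form.\<close>

lemma has_derivative_bilinear_expansion:
  fixes V W :: "'g::real_normed_vector \<Rightarrow> 'e::euclidean_space"
    and f :: "'g \<Rightarrow> 'f::real_normed_vector" and G :: "'e \<Rightarrow> 'e \<Rightarrow> 'f \<Rightarrow> real"
  assumes f: "(f has_derivative f') (at x)"
    and V: "(V has_derivative V') (at x)" and W: "(W has_derivative W') (at x)"
    and G: "\<And>i j. (G i j has_derivative G' i j) (at (f x))"
  shows "((\<lambda>y. \<Sum>i\<in>Basis. \<Sum>j\<in>Basis. (V y \<bullet> i) * (W y \<bullet> j) * G i j (f y)) has_derivative
    (\<lambda>h. (\<Sum>i\<in>Basis. \<Sum>j\<in>Basis. (V' h \<bullet> i) * (W x \<bullet> j) * G i j (f x)) +
          (\<Sum>i\<in>Basis. \<Sum>j\<in>Basis. (V x \<bullet> i) * (W' h \<bullet> j) * G i j (f x)) +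
          (\<Sum>i\<in>Basis. \<Sum>j\<in>Basis. (V x \<bullet> i) * (W x \<bullet> j) * G' i j (f' h)))) (at x)"
proof -
  have G': "((\<lambda>y. G i j (f y)) has_derivative (\<lambda>h. G' i j (f' h))) (at x)" for i j
    using has_derivative_compose[OF f G] .
  have "((\<lambda>y. (V y \<bullet> i) * (W y \<bullet> j) * G i j (f y)) has_derivative
      (\<lambda>h. (V' h \<bullet> i) * (W x \<bullet> j) * G i j (f x) + (V x \<bullet> i) * (W' h \<bullet> j) * G i j (f x) +
        (V x \<bullet> i) * (W x \<bullet> j) * G' i j (f' h))) (at x)" for i j
    by (rule has_derivative_eq_rhs, rule has_derivative_mult[OF has_derivative_mult[OF
          has_derivative_inner_left[OF V] has_derivative_inner_left[OF W]] G'])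
      (simp add: fun_eq_iff algebra_simps)
  then have "((\<lambda>y. \<Sum>i\<in>Basis. \<Sum>j\<in>Basis. (V y \<bullet> i) * (W y \<bullet> j) * G i j (f y)) has_derivative
    (\<lambda>h. \<Sum>i\<in>Basis. \<Sum>j\<in>Basis. (V' h \<bullet> i) * (W x \<bullet> j) * G i j (f x) +
        (V x \<bullet> i) * (W' h \<bullet> j) * G i j (f x) + (V x \<bullet> i) * (W x \<bullet> j) * G' i j (f' h))) (at x)"
    by (intro has_derivative_sum)
  then show ?thesis by (simp add: sum.distrib)
qed

context smooth_atlas
begin

text \<open>The derivative along \<open>u\<close> of the components of \<open>F\<close> in the preferred chart at \<open>p\<close>, evaluated
  on \<open>v\<close> and \<open>w\<close>. It is not a tensor, but its alternating sum \<open>ext_at\<close> is the value of the exterior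
  derivative on three tangent vectors.\<close>

definition form_deriv :: "('a, 'e) form2 \<Rightarrow> 'a \<Rightarrow> 'e \<Rightarrow> 'e \<Rightarrow> 'e \<Rightarrow> real" where
  "form_deriv F p u v w = (\<Sum>i\<in>Basis. \<Sum>j\<in>Basis. (v \<bullet> i) * (w \<bullet> j) *
     mderiv A (\<lambda>q. F q (coord_field A (chart_at A p) i q) (coord_field A (chart_at A p) j q)) p u)"

definition ext_at :: "('a, 'e) form2 \<Rightarrow> 'a \<Rightarrow> 'e \<Rightarrow> 'e \<Rightarrow> 'e \<Rightarrow> real" where
  "ext_at F p u v w = form_deriv F p u v w - form_deriv F p v u w + form_deriv F p w u v"

lemma msmooth_on_components_form:
  assumes "smooth_bilinear A F" "c \<in> A"
  shows "msmooth_on A (fst c) (\<lambda>q. F q (coord_field A c u q) (coord_field A c v q))"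
  using assms smooth_vf_coord_field[OF assms(2)] open_dom[OF assms(2)] unfolding smooth_bilinear_def by blast

lemma linear_ext_at:
  assumes "smooth_bilinear A F"
  shows "linear (\<lambda>u. ext_at F p u v w)"
proof -
  let ?D = "\<lambda>i j. mderiv A (\<lambda>q. F q (coord_field A (chart_at A p) i q) (coord_field A (chart_at A p) j q)) p"
  have lin: "linear (?D i j)" for i j
    using linear_mderiv[OF open_dom[OF chart_at(1)] chart_at(2) msmooth_on_components_form[OF assms chart_at(1)]] .
  have 1: "linear (\<lambda>u. form_deriv F p u v w)" for v w
    unfolding form_deriv_def
    by (rule linearI) (simp_all add: linear_add[OF lin] linear_cmul[OF lin] distrib_left sum.distrib
        sum_distrib_left mult.left_commute)
  have 2: "linear (\<lambda>v. form_deriv F p u v w)" for u w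
    unfolding form_deriv_def
    by (rule linearI) (simp_all add: inner_add_left distrib_right sum.distrib sum_distrib_left mult.assoc)
  show ?thesis unfolding ext_at_def
    by (intro linear_compose_add linear_compose_sub 1 2)
qed

lemma form_expansion:
  assumes "smooth_bilinear A F" "c \<in> A" "q \<in> fst c"
  shows "F q u v = (\<Sum>i\<in>Basis. \<Sum>j\<in>Basis. (mderiv A (snd c) q u \<bullet> i) * (mderiv A (snd c) q v \<bullet> j) *
    F q (coord_field A c i q) (coord_field A c j q))"
proof -
  have bil: "linear (F q u)" "linear (\<lambda>u. F q u v)" for u v
    using assms(1) unfolding smooth_bilinear_def bilinear_def by auto
  have "bilinear (\<lambda>x y. F q (coord_field A c x q) (coord_field A c y q))"
    unfolding bilinear_def
    using linear_compose[OF linear_coord_field[OF assms(2,3)] bil(1)]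
      linear_compose[OF linear_coord_field[OF assms(2,3)] bil(2)] by (simp add: o_def)
  from bilinear_expansion[OF this, of "mderiv A (snd c) q u" "mderiv A (snd c) q v"]
  show ?thesis by (simp add: coord_field_components[OF assms(2,3)])
qed

lemma form_expansion_at:
  assumes "smooth_bilinear A F"
  shows "F p u v = (\<Sum>i\<in>Basis. \<Sum>j\<in>Basis. (u \<bullet> i) * (v \<bullet> j) * F p i j)"
  using form_expansion[OF assms chart_at, of p u v] by simp

lemma mderiv_form:
  assumes F: "smooth_bilinear A F" and U: "open U" "p \<in> U" and YZ: "smooth_vf A U Y" "smooth_vf A U Z"
  defines "c \<equiv> chart_at A p"
  shows "mderiv A (\<lambda>q. F q (Y q) (Z q)) p u =
    F p (mderiv A (\<lambda>q. mderiv A (snd c) q (Y q)) p u) (Z p) +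
    F p (Y p) (mderiv A (\<lambda>q. mderiv A (snd c) q (Z q)) p u) + form_deriv F p u (Y p) (Z p)"
proof -
  have c: "c \<in> A" "p \<in> fst c" unfolding c_def using chart_at .
  let ?V = "fst c \<inter> U" and ?x = "snd c p"
  have V: "open ?V" "p \<in> ?V" using U c open_dom[OF c(1)] by (auto intro: open_Int)
  define y where "y = (\<lambda>q. mderiv A (snd c) q (Y q)) \<circ> chart_inv c"
  define z where "z = (\<lambda>q. mderiv A (snd c) q (Z q)) \<circ> chart_inv c"
  define G where "G i j = (\<lambda>q. F q (coord_field A c i q) (coord_field A c j q)) \<circ> chart_inv c" for i j
  have y': "(y has_derivative mderiv A (\<lambda>q. mderiv A (snd c) q (Y q)) p) (at ?x)"
    using mderiv_chart(3)[OF V smooth_vf_components[OF YZ(1) c(1)] c] unfolding y_def c_def .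
  have z': "(z has_derivative mderiv A (\<lambda>q. mderiv A (snd c) q (Z q)) p) (at ?x)"
    using mderiv_chart(3)[OF V smooth_vf_components[OF YZ(2) c(1)] c] unfolding z_def c_def .
  have G': "(G i j has_derivative mderiv A (\<lambda>q. F q (coord_field A c i q) (coord_field A c j q)) p) (at ?x)" for i j
    using mderiv_chart(3)[OF open_dom[OF c(1)] c(2) msmooth_on_components_form[OF F c(1)] c, of i j]
    unfolding G_def c_def .
  have x: "chart_inv c ?x = p" using chart_inv_chart[OF c] .
  have at_p: "y ?x = Y p" "z ?x = Z p" "G i j ?x = F p i j" for i j
    unfolding y_def z_def G_def o_def x unfolding c_def by simp_all
  have eq: "((\<lambda>q. F q (Y q) (Z q)) \<circ> chart_inv c) x =
      (\<Sum>i\<in>Basis. \<Sum>j\<in>Basis. (y x \<bullet> i) * (z x \<bullet> j) * G i j x)" if "x \<in> snd c ` ?V" for x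
    using form_expansion[OF F c(1)] chart_chart_inv(2)[OF c(1)] that
    by (auto simp: y_def z_def G_def)
  have o: "open (snd c ` ?V)" "?x \<in> snd c ` ?V" using open_image[OF c(1) U(1)] V(2) by auto
  have "(((\<lambda>q. F q (Y q) (Z q)) \<circ> chart_inv c) has_derivative (\<lambda>h.
     (\<Sum>i\<in>Basis. \<Sum>j\<in>Basis. (mderiv A (\<lambda>q. mderiv A (snd c) q (Y q)) p h \<bullet> i) * (z ?x \<bullet> j) * G i j ?x) +
     (\<Sum>i\<in>Basis. \<Sum>j\<in>Basis. (y ?x \<bullet> i) * (mderiv A (\<lambda>q. mderiv A (snd c) q (Z q)) p h \<bullet> j) * G i j ?x) +
     (\<Sum>i\<in>Basis. \<Sum>j\<in>Basis. (y ?x \<bullet> i) * (z ?x \<bullet> j) *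
        mderiv A (\<lambda>q. F q (coord_field A c i q) (coord_field A c j q)) p h))) (at ?x)"
    by (rule iffD2[OF dderiv_cong(1)[OF o eq]
          has_derivative_bilinear_expansion[OF has_derivative_ident y' z' G']])
  from dderiv_eq[OF this, of u] show ?thesis
    unfolding at_p form_expansion_at[OF F, symmetric] unfolding form_deriv_def c_def[symmetric]
    unfolding mderiv_def[of A "\<lambda>q. F q (Y q) (Z q)"] c_def[symmetric] .
qed

text \<open>Tensoriality: the terms in which the components of the fields are differentiated cancel
  against the Lie brackets.\<close>

lemma ext_deriv2_eq_ext_at:
  assumes F: "smooth_bilinear A F" "alternating F" and U: "open U" "p \<in> U"
    and XYZ: "smooth_vf A U X" "smooth_vf A U Y" "smooth_vf A U Z"
  shows "ext_deriv2 A F X Y Z p = ext_at F p (X p) (Y p) (Z p)"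
proof -
  let ?D = "\<lambda>Y u. mderiv A (\<lambda>q. mderiv A (snd (chart_at A p)) q (Y q)) p u"
  have lin: "linear (\<lambda>u. F p u v)" for v
    using F(1) unfolding smooth_bilinear_def bilinear_def by auto
  note md = mderiv_form[OF F(1) U]
  have lie: "F p (lie_bracket A X Y p) v = F p (?D Y (X p)) v - F p (?D X (Y p)) v" for X Y v
    unfolding lie_bracket_def using linear_diff[OF lin] by simp
  have "F p (Y p) (?D Z (X p)) = - F p (?D Z (X p)) (Y p)"
    "F p (X p) (?D Z (Y p)) = - F p (?D Z (Y p)) (X p)"
    "F p (X p) (?D Y (Z p)) = - F p (?D Y (Z p)) (X p)"
    by (rule alternatingD[OF F(2)])+
  then show ?thesis
    unfolding ext_deriv2_def ext_at_def lie md[OF XYZ(2,3)] md[OF XYZ(1,3)] md[OF XYZ(1,2)] by simp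
qed

lemma ext_deriv2_coord_field:
  fixes p
  assumes F: "smooth_bilinear A F"
  defines "K \<equiv> coord_field A (chart_at A p)"
  shows "ext_deriv2 A F (K u) (K v) (K w) p =
    mderiv A (\<lambda>q. F q (K v q) (K w q)) p u - mderiv A (\<lambda>q. F q (K u q) (K w q)) p v +
    mderiv A (\<lambda>q. F q (K u q) (K v q)) p w"
proof -
  let ?c = "chart_at A p"
  have "mderiv A (\<lambda>q. mderiv A (snd ?c) q (K u q)) p v = mderiv A (\<lambda>q. u) p v" for u v
    unfolding K_def
    by (rule mderiv_cong[OF open_dom[OF chart_at(1)] chart_at(2)])
      (rule components_coord_field[OF chart_at(1)])
  also have "mderiv A (\<lambda>q. u) p v = 0" for u v :: 'e unfolding mderiv_def o_def by simp
  finally have "lie_bracket A (K u) (K v) p = 0" for u v unfolding lie_bracket_def by simp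
  moreover have "F p 0 v = 0" for v
    using F linear_0[of "\<lambda>u. F p u v"] unfolding smooth_bilinear_def bilinear_def by blast
  moreover have "K u p = u" for u unfolding K_def by simp
  ultimately show ?thesis unfolding ext_deriv2_def by simp
qed

end

section \<open>Pulling back along a smooth map\<close>

locale manifold_map = M: smooth_atlas A + N: smooth_atlas B
  for A :: "('a::{t2_space,second_countable_topology}, 'e::euclidean_space) atlas"
    and B :: "('b::{t2_space,second_countable_topology}, 'f::euclidean_space) atlas" +
  fixes \<pi> :: "'a \<Rightarrow> 'b"
  assumes smooth_map: "smooth_map A B \<pi>"
begin

abbreviation "T \<equiv> tangent_map A B \<pi>"

lemma open_vimage_\<pi>: "open U \<Longrightarrow> open (\<pi> -` U)"
  using smooth_map unfolding smooth_map_def by (simp add: open_vimage)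

lemma msmooth_on_\<pi>: "d \<in> B \<Longrightarrow> msmooth_on A (\<pi> -` fst d) (snd d \<circ> \<pi>)"
  using smooth_map unfolding smooth_map_def by blast

lemma open_vimage_dom: "d \<in> B \<Longrightarrow> open (\<pi> -` fst d)"
  using open_vimage_\<pi> N.open_dom by blast

lemma linear_T: "linear (T p)"
  unfolding tangent_map_def
  by (rule M.linear_mderiv[OF open_vimage_dom[OF N.chart_at(1)] _ msmooth_on_\<pi>[OF N.chart_at(1)]])
    (simp add: N.chart_at(2))

lemma mderiv_pullback:
  assumes "open V" "\<pi> p \<in> V" "msmooth_on B V h"
  shows "mderiv A (h \<circ> \<pi>) p v = mderiv B h (\<pi> p) (T p v)"
proof -
  let ?c = "chart_at A p" and ?d = "chart_at B (\<pi> p)"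
  note c = M.chart_at[of p] and d = N.chart_at[of "\<pi> p"]
  let ?S = "snd ?c ` (fst ?c \<inter> \<pi> -` fst ?d)"
  have S: "open ?S" "snd ?c p \<in> ?S"
    using M.open_image[OF c(1) open_vimage_dom[OF d(1)]] c d by auto
  have eq: "((h \<circ> \<pi>) \<circ> chart_inv ?c) x = (h \<circ> chart_inv ?d) (((snd ?d \<circ> \<pi>) \<circ> chart_inv ?c) x)"
    if "x \<in> ?S" for x
    using M.chart_chart_inv(2)[OF c(1) that] N.chart_inv_chart[OF d(1)] by simp
  have p: "((snd ?d \<circ> \<pi>) \<circ> chart_inv ?c) (snd ?c p) = snd ?d (\<pi> p)"
    using M.chart_inv_chart[OF c] by simp
  have 1: "(((snd ?d \<circ> \<pi>) \<circ> chart_inv ?c) has_derivative T p) (at (snd ?c p))"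
    unfolding tangent_map_def
    by (rule M.mderiv_chart(3)[OF open_vimage_dom[OF d(1)] _ msmooth_on_\<pi>[OF d(1)] c]) (use d in auto)
  have 2: "((h \<circ> chart_inv ?d) has_derivative mderiv B h (\<pi> p)) (at (snd ?d (\<pi> p)))"
    by (rule N.mderiv_chart(3)[OF assms d])
  have "(((h \<circ> \<pi>) \<circ> chart_inv ?c) has_derivative (\<lambda>v. mderiv B h (\<pi> p) (T p v))) (at (snd ?c p))"
    by (rule iffD2[OF dderiv_cong(1)[OF S eq]])
      (use has_derivative_compose[OF 1 2[folded p]] in simp_all)
  from dderiv_eq[OF this] show ?thesis by (simp add: mderiv_def)
qed

lemma components_T:
  assumes "d \<in> B" "\<pi> q \<in> fst d"
  shows "mderiv B (snd d) (\<pi> q) (T q v) = mderiv A (snd d \<circ> \<pi>) q v"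
  using mderiv_pullback[OF N.open_dom[OF assms(1)] assms(2) N.msmooth_on_chart[OF assms(1)]] by simp

definition \<pi>_in_charts :: "'a \<Rightarrow> 'e \<Rightarrow> 'f" where
  "\<pi>_in_charts p = (snd (chart_at B (\<pi> p)) \<circ> \<pi>) \<circ> chart_inv (chart_at A p)"

abbreviation "Hess p u v \<equiv> dderiv (\<lambda>x. dderiv (\<pi>_in_charts p) x u) (snd (chart_at A p) p) v"

lemma \<pi>_in_charts:
  defines "S \<equiv> \<lambda>p. snd (chart_at A p) ` (fst (chart_at A p) \<inter> \<pi> -` fst (chart_at B (\<pi> p)))"
  shows "open (S p)" "snd (chart_at A p) p \<in> S p" "smooth_on (S p) (\<pi>_in_charts p)"
  using M.open_image[OF M.chart_at(1) open_vimage_dom[OF N.chart_at(1)]] M.chart_at N.chart_at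
    M.msmooth_onD[OF msmooth_on_\<pi>[OF N.chart_at(1)] M.chart_at(1)]
  unfolding S_def \<pi>_in_charts_def by auto

lemma dderiv_\<pi>_in_charts: "dderiv (\<pi>_in_charts p) (snd (chart_at A p) p) v = T p v"
  unfolding \<pi>_in_charts_def tangent_map_def mderiv_def ..

lemma Hess_commute: "Hess p u v = Hess p v u"
  using symmetric_second_derivative[OF \<pi>_in_charts(3,1,2)] .

text \<open>The two terms with second derivatives come from the coordinate fields of the domain, whose
  images under \<open>T\<close> do not have constant components.\<close>

lemma has_derivative_pullback:
  fixes p
  assumes F: "smooth_bilinear B F"
  defines "K \<equiv> coord_field A (chart_at A p)"
  shows "((\<lambda>q. F (\<pi> q) (T q (K v q)) (T q (K w q))) \<circ> chart_inv (chart_at A p) has_derivative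
    (\<lambda>h. F (\<pi> p) (Hess p v h) (T p w) + F (\<pi> p) (T p v) (Hess p w h) +
       N.form_deriv F (\<pi> p) (T p h) (T p v) (T p w))) (at (snd (chart_at A p) p))"
proof -
  let ?c = "chart_at A p" and ?d = "chart_at B (\<pi> p)"
  let ?S = "snd ?c ` (fst ?c \<inter> \<pi> -` fst ?d)" and ?x = "snd ?c p"
  note c = M.chart_at[of p] and d = N.chart_at[of "\<pi> p"]
  let ?f = "\<pi>_in_charts p"
  define G where "G i j = (\<lambda>y. F y (coord_field B ?d i y) (coord_field B ?d j y)) \<circ> chart_inv ?d" for i j
  have fx: "?f ?x = snd ?d (\<pi> p)" unfolding \<pi>_in_charts_def using M.chart_inv_chart[OF c] by simp
  have G': "(G i j has_derivative mderiv B (\<lambda>y. F y (coord_field B ?d i y) (coord_field B ?d j y)) (\<pi> p))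
      (at (?f ?x))" for i j
    unfolding G_def fx
    by (rule N.mderiv_chart(3)[OF N.open_dom[OF d(1)] d(2) N.msmooth_on_components_form[OF F d(1)] d])
  have f': "(?f has_derivative T p) (at ?x)"
    using smooth_on_has_derivative[OF \<pi>_in_charts(3,2)] unfolding dderiv_\<pi>_in_charts[abs_def] by simp
  have V': "((\<lambda>x. dderiv ?f x v) has_derivative Hess p v) (at ?x)" for v
    by (rule smooth_on_has_derivative[OF smooth_on_dderiv[OF \<pi>_in_charts(3)] \<pi>_in_charts(2)])
  have eq: "((\<lambda>q. F (\<pi> q) (T q (K v q)) (T q (K w q))) \<circ> chart_inv ?c) x =
      (\<Sum>i\<in>Basis. \<Sum>j\<in>Basis. (dderiv ?f x v \<bullet> i) * (dderiv ?f x w \<bullet> j) * G i j (?f x))"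
    if x: "x \<in> ?S" for x
  proof -
    define q where "q = chart_inv ?c x"
    have q: "snd ?c q = x" "q \<in> fst ?c" "\<pi> q \<in> fst ?d"
      using M.chart_chart_inv[OF c(1) x] unfolding q_def by auto
    have inv: "chart_inv ?d (?f x) = \<pi> q"
      unfolding \<pi>_in_charts_def using N.chart_inv_chart[OF d(1) q(3)] by (simp add: q_def)
    have "mderiv B (snd ?d) (\<pi> q) (T q (K v q)) = dderiv ?f x v" for v
      unfolding components_T[OF d(1) q(3)] K_def \<pi>_in_charts_def q(1)[symmetric]
      by (rule M.mderiv_chart(4)[OF open_vimage_dom[OF d(1)] _ msmooth_on_\<pi>[OF d(1)] c(1) q(2)])
        (use q in simp)
    then show ?thesis
      using N.form_expansion[OF F d(1) q(3), of "T q (K v q)" "T q (K w q)"]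
      by (simp add: G_def inv q_def[symmetric])
  qed
  have Gp: "G i j (?f ?x) = F (\<pi> p) i j" for i j
    unfolding G_def fx using N.chart_inv_chart[OF d] by simp
  have "((\<lambda>q. F (\<pi> q) (T q (K v q)) (T q (K w q))) \<circ> chart_inv ?c has_derivative (\<lambda>h.
     (\<Sum>i\<in>Basis. \<Sum>j\<in>Basis. (Hess p v h \<bullet> i) * (dderiv ?f ?x w \<bullet> j) * G i j (?f ?x)) +
     (\<Sum>i\<in>Basis. \<Sum>j\<in>Basis. (dderiv ?f ?x v \<bullet> i) * (Hess p w h \<bullet> j) * G i j (?f ?x)) +
     (\<Sum>i\<in>Basis. \<Sum>j\<in>Basis. (dderiv ?f ?x v \<bullet> i) * (dderiv ?f ?x w \<bullet> j) *
       mderiv B (\<lambda>y. F y (coord_field B ?d i y) (coord_field B ?d j y)) (\<pi> p) (T p h)))) (at ?x)"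
    by (rule iffD2[OF dderiv_cong(1)[OF \<pi>_in_charts(1,2) eq]
          has_derivative_bilinear_expansion[OF f' V' V' G']])
  then show ?thesis
    unfolding Gp N.form_expansion_at[OF F, symmetric] dderiv_\<pi>_in_charts N.form_deriv_def .
qed

end

section \<open>Lee forms of almost Hermitian manifolds\<close>

lemma (in smooth_atlas) mderiv_minus:
  assumes "open U" "p \<in> U" "msmooth_on A U f"
  shows "mderiv A (\<lambda>q. - f q) p v = - mderiv A f p v"
  using dderiv_eq[OF has_derivative_minus[OF mderiv_chart(3)[OF assms chart_at]]]
  by (simp add: mderiv_def o_def)

locale hermitian_manifold =
  fixes A :: "('a::{t2_space,second_countable_topology}, 'e::euclidean_space) atlas"
    and J :: "('a, 'e) endo" and g :: "('a, 'e) form2" and D :: "('a, 'e) conn"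
  assumes almost_hermitian: "almost_hermitian A J g" and levi_civita: "levi_civita A g D"

sublocale hermitian_manifold \<subseteq> riemannian_manifold A g
  using almost_hermitian by unfold_locales (auto simp: almost_hermitian_def)

context hermitian_manifold
begin

abbreviation "\<Omega> \<equiv> fundamental_form g J"

lemma linear_J: "linear (J p)"
  using almost_hermitian unfolding almost_hermitian_def endo_field_def by blast

lemma smooth_vf_J: "open U \<Longrightarrow> smooth_vf A U X \<Longrightarrow> smooth_vf A U (\<lambda>p. J p (X p))"
  using almost_hermitian unfolding almost_hermitian_def endo_field_def by blast

lemma J_J: "J p (J p u) = - u" and g_J_J: "g p (J p u) (J p v) = g p u v"
  using almost_hermitian unfolding almost_hermitian_def by blast+

lemma g_J_left: "g p (J p u) v = - g p u (J p v)"
  using g_J_J[of p "J p u" v] by (simp add: J_J g_simps)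

lemma smooth_bilinear_\<Omega>: "smooth_bilinear A \<Omega>"
  unfolding smooth_bilinear_def fundamental_form_def bilinear_def
  using linear_compose[OF linear_J g_linear(1)] g_linear(2) msmooth_on_g smooth_vf_J by (simp add: o_def)

lemma alternating_\<Omega>: "alternating \<Omega>"
  unfolding alternating_def fundamental_form_def using g_J_left g_commute by metis

lemma orthonormal_J: "orthonormal p e k \<Longrightarrow> orthonormal p (\<lambda>i. J p (e i)) k"
  unfolding orthonormal_def by (simp add: g_J_J)

text \<open>In \<open>\<theta> \<and> \<Omega>\<close>, contraction with \<open>\<Omega>\<close> returns \<open>\<theta>\<close> with a factor that does not vanish in
  dimension above 2; thus \<open>\<theta>\<close> can be recovered from \<open>\<theta> \<and> \<Omega>\<close>.\<close>

lemma contraction_wedge: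
  assumes e: "orthonormal p e (DIM('e))" and "linear (\<theta> p)"
  shows "(\<Sum>i<DIM('e). wedge12 \<theta> \<Omega> p (e i) (J p (e i)) w) = (2 - real (DIM('e))) * \<theta> p w"
proof -
  let ?n = "DIM('e)"
  have expand: "(\<Sum>i<?n. \<theta> p (f i) * g p w (f i)) = \<theta> p w" if "orthonormal p f ?n" for f
  proof -
    have "\<theta> p w = \<theta> p (\<Sum>i<?n. g p w (f i) *\<^sub>R f i)" using orthonormal_expansion[OF that] by metis
    then show ?thesis using assms(2) by (simp add: linear_sum linear_cmul mult.commute)
  qed
  have "wedge12 \<theta> \<Omega> p (e i) (J p (e i)) w =
      \<theta> p (e i) * g p w (e i) + \<theta> p (J p (e i)) * g p w (J p (e i)) - \<theta> p w" if "i < ?n" for i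
  proof -
    have "g p (e i) (e i) = 1" using e that unfolding orthonormal_def by simp
    then show ?thesis
      using g_commute[of p "e i" w]
      by (simp add: wedge12_def fundamental_form_def g_J_J J_J g_simps)
  qed
  then have "(\<Sum>i<?n. wedge12 \<theta> \<Omega> p (e i) (J p (e i)) w) =
      (\<Sum>i<?n. \<theta> p (e i) * g p w (e i) + \<theta> p (J p (e i)) * g p w (J p (e i)) - \<theta> p w)"
    by (intro sum.cong) auto
  also have "\<dots> = 2 * \<theta> p w - real ?n * \<theta> p w"
    using expand[OF e] expand[OF orthonormal_J[OF e]] by (simp add: sum.distrib sum_subtractf)
  finally show ?thesis by (simp add: left_diff_distrib)
qed

text \<open>A solution \<open>\<theta>\<close> of the Lee equation at a point is automatically linear: evaluated on \<open>x\<close>, \<open>a\<close>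
  and \<open>J a\<close>, all terms other than \<open>\<theta> x \<Omega>(a, J a)\<close> are linear in \<open>x\<close>.\<close>

lemma lee_solution_linear:
  assumes eq: "\<And>u v w. ext_at \<Omega> p u v w = - 2 * wedge12 \<theta> \<Omega> p u v w"
  shows "linear (\<theta> p)"
proof -
  obtain a :: 'e where a: "a \<noteq> 0" using nonempty_Basis nonzero_Basis by blast
  let ?b = "J p a"
  have k: "\<Omega> p a ?b \<noteq> 0"
    using g_pos[OF a, of p] by (simp add: fundamental_form_def J_J g_simps)
  have \<Omega>: "linear (\<Omega> p u)" "linear (\<lambda>u. \<Omega> p u v)" for u v
    using smooth_bilinear_\<Omega> unfolding smooth_bilinear_def bilinear_def by blast+
  define h where "h x = (-1/2) * ext_at \<Omega> p x a ?b - \<theta> p a * \<Omega> p ?b x - \<theta> p ?b * \<Omega> p x a" for x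
  have "h x = \<theta> p x * \<Omega> p a ?b" for x
    unfolding h_def eq wedge12_def by (simp add: field_simps)
  moreover have "linear h"
    by (rule linearI) (simp_all add: h_def algebra_simps linear_add[OF \<Omega>(1)] linear_add[OF \<Omega>(2)]
        linear_cmul[OF \<Omega>(1)] linear_cmul[OF \<Omega>(2)] linear_add[OF linear_ext_at[OF smooth_bilinear_\<Omega>]]
        linear_cmul[OF linear_ext_at[OF smooth_bilinear_\<Omega>]])
  ultimately have "\<theta> p = (\<lambda>x. (1 / \<Omega> p a ?b) *\<^sub>R h x)" using k by (auto simp: fun_eq_iff)
  then show ?thesis using linear_compose_scale_right[OF \<open>linear h\<close>] by metis
qed

lemma connection: "connection A D"
  using levi_civita unfolding levi_civita_def by (rule conjunct1)

lemma D_smooth: "open U \<Longrightarrow> smooth_vf A U X \<Longrightarrow> smooth_vf A U Y \<Longrightarrow> smooth_vf A U (D X Y)"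
  using connection[unfolded connection_def, THEN conjunct1] by blast

lemma D_add_left:
  "open U \<Longrightarrow> smooth_vf A U X \<Longrightarrow> smooth_vf A U Y \<Longrightarrow> smooth_vf A U Z \<Longrightarrow> p \<in> U \<Longrightarrow>
   D (\<lambda>q. X q + Y q) Z p = D X Z p + D Y Z p"
  using connection[unfolded connection_def, THEN conjunct2, THEN conjunct1, rule_format] by blast

lemma D_scaleR_left:
  "open U \<Longrightarrow> smooth_vf A U X \<Longrightarrow> smooth_vf A U Y \<Longrightarrow> msmooth_on A U f \<Longrightarrow> p \<in> U \<Longrightarrow>
   D (\<lambda>q. f q *\<^sub>R X q) Y p = f p *\<^sub>R D X Y p"
  using connection[unfolded connection_def, THEN conjunct2, THEN conjunct2, rule_format] by blast

lemma D_torsion_free: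
  "open U \<Longrightarrow> smooth_vf A U X \<Longrightarrow> smooth_vf A U Y \<Longrightarrow> p \<in> U \<Longrightarrow>
   lie_bracket A X Y p = D X Y p - D Y X p"
  using levi_civita[unfolded levi_civita_def, THEN conjunct2, THEN conjunct1, rule_format, of U X Y p]
  by simp

lemma D_metric:
  "open U \<Longrightarrow> smooth_vf A U X \<Longrightarrow> smooth_vf A U Y \<Longrightarrow> smooth_vf A U Z \<Longrightarrow> p \<in> U \<Longrightarrow>
   mderiv A (\<lambda>q. g q (Y q) (Z q)) p (X p) = g p (D X Y p) (Z p) + g p (Y p) (D X Z p)"
  using levi_civita[unfolded levi_civita_def, THEN conjunct2, THEN conjunct2, rule_format] by blast

text \<open>The connection acts on fields defined everywhere, and its linearity over functions makes it local in
  the first argument: multiplying both fields by the indicator function of \<open>U\<close>, which is smooth on \<open>U\<close>, makes them equal everywhere.\<close>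

lemma D_cong_left:
  assumes "open U" "p \<in> U" "smooth_vf A U X" "smooth_vf A U Y" "\<And>q. q \<in> U \<Longrightarrow> X q = X' q"
  shows "D X Y p = D X' Y p"
proof -
  let ?f = "\<lambda>q. if q \<in> U then 1 else 0 :: real"
  have f: "msmooth_on A U ?f"
    by (subst msmooth_on_cong[OF assms(1), where g = "\<lambda>_. 1"]) (auto intro: msmooth_on_const assms(1))
  have X': "smooth_vf A U X'" using smooth_vf_cong[OF assms(1), of X X'] assms(3,5) by blast
  have "(\<lambda>q. ?f q *\<^sub>R X q) = (\<lambda>q. ?f q *\<^sub>R X' q)" using assms(5) by auto
  then show ?thesis
    using D_scaleR_left[OF assms(1,3,4) f assms(2)] D_scaleR_left[OF assms(1) X' assms(4) f assms(2)]
      assms(2) by simp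
qed

lemma D_sum_left:
  assumes "open U" "p \<in> U" "smooth_vf A U Y"
    and "\<And>j. j < k \<Longrightarrow> msmooth_on A U (a j)" "\<And>j. j < k \<Longrightarrow> smooth_vf A U (E j)"
  shows "D (\<lambda>q. \<Sum>j<k. a j q *\<^sub>R E j q) Y p = (\<Sum>j<(k::nat). a j p *\<^sub>R D (E j) Y p)"
  using assms(4,5)
proof (induction k)
  case 0
  show ?case
    using D_scaleR_left[OF assms(1,3,3) msmooth_on_const[OF assms(1)] assms(2), of 0] by simp
next
  case (Suc k)
  have "D (\<lambda>q. (\<Sum>j<k. a j q *\<^sub>R E j q) + a k q *\<^sub>R E k q) Y p =
      D (\<lambda>q. \<Sum>j<k. a j q *\<^sub>R E j q) Y p + D (\<lambda>q. a k q *\<^sub>R E k q) Y p"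
    by (rule D_add_left[OF assms(1) smooth_vf_sum smooth_vf_scaleR assms(3,2)])
      (auto intro!: smooth_vf_scaleR assms(1) Suc.prems)
  also have "D (\<lambda>q. a k q *\<^sub>R E k q) Y p = a k p *\<^sub>R D (E k) Y p"
    by (rule D_scaleR_left[OF assms(1) _ assms(3) _ assms(2)]) (auto intro: Suc.prems)
  also have "D (\<lambda>q. \<Sum>j<k. a j q *\<^sub>R E j q) Y p = (\<Sum>j<k. a j p *\<^sub>R D (E j) Y p)"
    by (rule Suc.IH) (auto intro: Suc.prems)
  finally show ?case by simp
qed

context
  fixes U :: "'a set" and p :: 'a
  assumes U: "open U" "p \<in> U"
begin

text \<open>This is \<open>g(Y, (\<nabla>\<^sub>X J) Z)\<close>, by compatibility of \<open>D\<close> with the metric.\<close>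

lemma cov2_eq:
  assumes "smooth_vf A U X" "smooth_vf A U Y" "smooth_vf A U Z"
  shows "cov2 A D \<Omega> X Y Z p = g p (Y p) (D X (\<lambda>q. J q (Z q)) p - J p (D X Z p))"
  using D_metric[OF U(1) assms(1,2) smooth_vf_J[OF U(1) assms(3)] U(2)]
  by (simp add: cov2_def fundamental_form_def g_simps)

lemma cov2_alternating:
  assumes "smooth_vf A U X" "smooth_vf A U Y" "smooth_vf A U Z"
  shows "cov2 A D \<Omega> X Y Z p = - cov2 A D \<Omega> X Z Y p"
proof -
  have "msmooth_on A U (\<lambda>q. \<Omega> q (Z q) (Y q))"
    using smooth_bilinear_\<Omega> U(1) assms unfolding smooth_bilinear_def by blast
  from mderiv_minus[OF U this, of "X p"]
  have "mderiv A (\<lambda>q. \<Omega> q (Y q) (Z q)) p (X p) = - mderiv A (\<lambda>q. \<Omega> q (Z q) (Y q)) p (X p)"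
    using alternatingD[OF alternating_\<Omega>, of _ "Y _" "Z _"] by simp
  then show ?thesis
    using alternatingD[OF alternating_\<Omega>, of p "D X Y p" "Z p"]
      alternatingD[OF alternating_\<Omega>, of p "Y p" "D X Z p"] by (simp add: cov2_def)
qed

text \<open>From \<open>J\<^sup>2 = -1\<close> it follows that \<open>\<nabla>\<^sub>X J\<close> anticommutes with \<open>J\<close>; as \<open>J\<close> is skew, it can be moved
  between the two arguments of \<open>\<nabla>\<^sub>X \<Omega>\<close>.\<close>

lemma cov2_J:
  assumes X: "smooth_vf A U X" and Y: "smooth_vf A U Y" and Z: "smooth_vf A U Z"
  shows "cov2 A D \<Omega> X (\<lambda>q. J q (Y q)) Z p = cov2 A D \<Omega> X Y (\<lambda>q. J q (Z q)) p"
proof -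
  note JY = smooth_vf_J[OF U(1) Y] and JZ = smooth_vf_J[OF U(1) Z]
  have "mderiv A (\<lambda>q. g q (J q (Y q)) (J q (Z q))) p (X p) = mderiv A (\<lambda>q. g q (Y q) (Z q)) p (X p)"
    by (simp add: g_J_J)
  moreover have "mderiv A (\<lambda>q. - g q (Y q) (Z q)) p (X p) = - mderiv A (\<lambda>q. g q (Y q) (Z q)) p (X p)"
    by (rule mderiv_minus[OF U msmooth_on_g[OF U(1) Y Z]])
  ultimately show ?thesis
    using D_metric[OF U(1) X JY JZ U(2)] D_metric[OF U(1) X Y Z U(2)]
    by (simp add: cov2_def fundamental_form_def J_J g_J_J g_simps g_J_left)
qed

lemma cov2_diagonal:
  assumes "smooth_vf A U X" "smooth_vf A U Y"
  shows "cov2 A D \<Omega> X Y (\<lambda>q. J q (Y q)) p = 0"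
  using cov2_J[OF assms assms(2)] cov2_alternating[OF assms smooth_vf_J[OF U(1) assms(2)]] by simp

text \<open>Tensoriality in the last argument follows from that in the middle one, which is
  manifest in the formula \<open>g(Y, (\<nabla>\<^sub>X J) Z)\<close>.\<close>

lemma cov2_tensorial:
  assumes "smooth_vf A U X" "smooth_vf A U Y" "smooth_vf A U Z" "smooth_vf A U Z'" "Z p = Z' p"
  shows "cov2 A D \<Omega> X Y Z p = cov2 A D \<Omega> X Y Z' p"
  using cov2_alternating[OF assms(1,2,3)] cov2_alternating[OF assms(1,2,4)]
    cov2_eq[OF assms(1,3,2)] cov2_eq[OF assms(1,4,2)] assms(5) by simp

lemma cov2_sum_left:
  assumes "smooth_vf A U X" and Y: "smooth_vf A U Y" and Z: "smooth_vf A U Z"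
    and a: "\<And>j. j < k \<Longrightarrow> msmooth_on A U (a j)" and E: "\<And>j. j < k \<Longrightarrow> smooth_vf A U (E j)"
    and eq: "\<And>q. q \<in> U \<Longrightarrow> X q = (\<Sum>j<k. a j q *\<^sub>R E j q)"
  shows "cov2 A D \<Omega> X Y Z p = (\<Sum>j<(k::nat). a j p * cov2 A D \<Omega> (E j) Y Z p)"
proof -
  have *: "D X V p = (\<Sum>j<k. a j p *\<^sub>R D (E j) V p)" if "smooth_vf A U V" for V
    using D_cong_left[OF U assms(1) that eq] D_sum_left[OF U that, of k a E] a E by simp
  have "cov2 A D \<Omega> X Y Z p = (\<Sum>j<k. a j p * g p (Y p) (D (E j) (\<lambda>q. J q (Z q)) p - J p (D (E j) Z p)))"
    unfolding cov2_eq[OF assms(1) Y Z] *[OF Z] *[OF smooth_vf_J[OF U(1) Z]]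
    by (simp add: linear_sum[OF linear_J] linear_cmul[OF linear_J] sum_subtractf[symmetric]
        scaleR_diff_right[symmetric] g_simps right_diff_distrib)
  then show ?thesis using cov2_eq[OF E Y Z] by simp
qed

lemma ext_deriv2_eq_cov2:
  assumes "smooth_vf A U X" "smooth_vf A U Y" "smooth_vf A U Z"
  shows "ext_deriv2 A \<Omega> X Y Z p =
    cov2 A D \<Omega> X Y Z p + cov2 A D \<Omega> Y Z X p + cov2 A D \<Omega> Z X Y p"
proof -
  have lin: "linear (\<lambda>u. \<Omega> p u v)" for v
    using smooth_bilinear_\<Omega> unfolding smooth_bilinear_def bilinear_def by blast
  have lie: "\<Omega> p (lie_bracket A V W p) v = \<Omega> p (D V W p) v - \<Omega> p (D W V p) v"
    if "smooth_vf A U V" "smooth_vf A U W" for V W v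
    using D_torsion_free[OF U(1) that U(2)] linear_diff[OF lin] by simp
  have "msmooth_on A U (\<lambda>q. \<Omega> q (X q) (Z q))"
    using smooth_bilinear_\<Omega> U(1) assms unfolding smooth_bilinear_def by blast
  from mderiv_minus[OF U this, of "Y p"]
  have "mderiv A (\<lambda>q. \<Omega> q (Z q) (X q)) p (Y p) = - mderiv A (\<lambda>q. \<Omega> q (X q) (Z q)) p (Y p)"
    using alternatingD[OF alternating_\<Omega>, of _ "Z _" "X _"] by simp
  then show ?thesis
    using alternatingD[OF alternating_\<Omega>, of p "D X Z p" "Y p"]
      alternatingD[OF alternating_\<Omega>, of p "D Y X p" "Z p"]
      alternatingD[OF alternating_\<Omega>, of p "D Z Y p" "X p"]
    unfolding ext_deriv2_def cov2_def lie[OF assms(1,2)] lie[OF assms(1,3)] lie[OF assms(2,3)] by simp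
qed

text \<open>Contracting \<open>d\<Omega>(e\<^sub>i, J e\<^sub>i, W)\<close> over an orthonormal frame: of the three covariant derivatives,
  the last is zero for each \<open>i\<close> (\<open>cov2_diagonal\<close>), and the first two have the same sum because
  \<open>J e\<^sub>i\<close> is an orthonormal frame too.\<close>

lemma sum_ext_deriv2_frame:
  assumes E: "\<And>i. i < DIM('e) \<Longrightarrow> smooth_vf A U (E i)"
    and on: "\<And>q. q \<in> U \<Longrightarrow> orthonormal q (\<lambda>i. E i q) (DIM('e))" and W: "smooth_vf A U W"
  shows "(\<Sum>i<DIM('e). ext_deriv2 A \<Omega> (E i) (\<lambda>q. J q (E i q)) W p) =
    2 * (\<Sum>i<DIM('e). cov2 A D \<Omega> (E i) (E i) (\<lambda>q. J q (W q)) p)"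
proof -
  let ?n = "DIM('e)"
  define F where "F i = (\<lambda>q. J q (E i q))" for i
  have F: "smooth_vf A U (F i)" if "i < ?n" for i
    unfolding F_def using smooth_vf_J[OF U(1) E[OF that]] .
  define S where "S j = D (E j) (\<lambda>q. J q (W q)) p - J p (D (E j) W p)" for j
  have ext: "ext_deriv2 A \<Omega> (E i) (F i) W p =
      cov2 A D \<Omega> (E i) (F i) W p + cov2 A D \<Omega> (F i) W (E i) p" if i: "i < ?n" for i
  proof -
    have "cov2 A D \<Omega> W (E i) (F i) p = 0" unfolding F_def by (rule cov2_diagonal[OF W E[OF i]])
    then show ?thesis using ext_deriv2_eq_cov2[OF E[OF i] F[OF i] W] by simp
  qed
  have cFE: "cov2 A D \<Omega> (F i) W (E i) p =
      - (\<Sum>j<?n. g p (F i p) (E j p) * g p (E i p) (S j))" if i: "i < ?n" for i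
  proof -
    \<comment> \<open>The argument \<open>J e\<^sub>i\<close> of the derivative is expanded in the frame on all of \<open>U\<close>.\<close>
    have "cov2 A D \<Omega> (F i) W (E i) p = (\<Sum>j<?n. g p (F i p) (E j p) * cov2 A D \<Omega> (E j) W (E i) p)"
      by (rule cov2_sum_left[OF F[OF i] W E[OF i]])
        (auto intro: msmooth_on_g U F[OF i] E orthonormal_expansion[OF on])
    also have "\<dots> = (\<Sum>j<?n. g p (F i p) (E j p) * - g p (E i p) (S j))"
    proof (rule sum.cong[OF refl])
      fix j assume "j \<in> {..<?n}"
      then have j: "j < ?n" by simp
      show "g p (F i p) (E j p) * cov2 A D \<Omega> (E j) W (E i) p =
          g p (F i p) (E j p) * - g p (E i p) (S j)"
        using cov2_alternating[OF E[OF j] W E[OF i]] cov2_eq[OF E[OF j] E[OF i] W]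
        unfolding S_def by simp
    qed
    finally show ?thesis by (simp add: sum_negf)
  qed
  have inner: "(\<Sum>i<?n. g p (F i p) (E j p) * g p (E i p) (S j)) = - g p (F j p) (S j)" for j
  proof -
    have "g p (F i p) (E j p) = - g p (F j p) (E i p)" for i
      unfolding F_def using g_J_left[of p "E i p" "E j p"] g_commute by metis
    moreover have "g p (F j p) (S j) = (\<Sum>i<?n. g p (F j p) (E i p) * g p (E i p) (S j))"
      using arg_cong[OF orthonormal_expansion[OF on[OF U(2)], of "F j p"], of "\<lambda>u. g p u (S j)"]
      by (simp add: g_simps)
    ultimately show ?thesis by (simp add: sum_negf)
  qed
  have "(\<Sum>i<?n. cov2 A D \<Omega> (F i) W (E i) p) =
      - (\<Sum>i<?n. \<Sum>j<?n. g p (F i p) (E j p) * g p (E i p) (S j))"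
    using cFE by (simp add: sum_negf)
  also have "\<dots> = - (\<Sum>j<?n. \<Sum>i<?n. g p (F i p) (E j p) * g p (E i p) (S j))"
    by (subst sum.swap) simp
  also have "\<dots> = - (\<Sum>j<?n. - g p (F j p) (S j))" unfolding inner ..
  also have "\<dots> = (\<Sum>j<?n. cov2 A D \<Omega> (E j) (F j) W p)"
    using cov2_eq[OF E F W] by (simp add: sum_negf S_def)
  finally have "(\<Sum>i<?n. ext_deriv2 A \<Omega> (E i) (F i) W p) = 2 * (\<Sum>i<?n. cov2 A D \<Omega> (E i) (F i) W p)"
    using ext by (simp add: sum.distrib)
  moreover have "cov2 A D \<Omega> (E i) (F i) W p = cov2 A D \<Omega> (E i) (E i) (\<lambda>q. J q (W q)) p" if "i < ?n" for i
    unfolding F_def by (rule cov2_J[OF E[OF that] E[OF that] W])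
  ultimately show ?thesis unfolding F_def by simp
qed

end

text \<open>The codifferential extends \<open>J w\<close> by a field of its own, which agrees with \<open>J W\<close>, for an extension
  \<open>W\<close> of \<open>w\<close>, only at \<open>p\<close>; tensoriality makes the two interchangeable.\<close>

lemma contraction_ext_at:
  obtains e where "orthonormal p e (DIM('e))"
    "(\<Sum>i<DIM('e). ext_at \<Omega> p (e i) (J p (e i)) w) = - 2 * codiff2 A g D \<Omega> p (J p w)"
proof -
  let ?E = "some_frame A g p" and ?W = "local_ext A p w" and ?Z = "local_ext A p (J p w)"
  obtain U1 where U1: "open U1" "p \<in> U1" and E1: "\<And>i. i < DIM('e) \<Longrightarrow> smooth_vf A U1 (?E i)"
    and on1: "\<And>q. q \<in> U1 \<Longrightarrow> orthonormal q (\<lambda>i. ?E i q) (DIM('e))"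
    using some_frame[of p] unfolding local_orthonormal_frame_def orthonormal_def by blast
  obtain U2 where U2: "open U2" "p \<in> U2" "smooth_vf A U2 ?W" using exists_local_ext(2) by blast
  obtain U3 where U3: "open U3" "p \<in> U3" "smooth_vf A U3 ?Z" using exists_local_ext(2) by blast
  define U where "U = U1 \<inter> U2 \<inter> U3"
  have U: "open U" "p \<in> U" using U1 U2 U3 by (auto simp: U_def)
  have E: "smooth_vf A U (?E i)" if "i < DIM('e)" for i
    by (rule smooth_vf_subset[OF E1[OF that]]) (auto simp: U_def)
  have on: "orthonormal q (\<lambda>i. ?E i q) (DIM('e))" if "q \<in> U" for q
    using that on1 by (simp add: U_def)
  have W: "smooth_vf A U ?W" by (rule smooth_vf_subset[OF U2(3)]) (auto simp: U_def)
  have Z: "smooth_vf A U ?Z" by (rule smooth_vf_subset[OF U3(3)]) (auto simp: U_def)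
  have "(\<Sum>i<DIM('e). ext_at \<Omega> p (?E i p) (J p (?E i p)) w) =
      (\<Sum>i<DIM('e). ext_deriv2 A \<Omega> (?E i) (\<lambda>q. J q (?E i q)) ?W p)"
  proof (rule sum.cong[OF refl])
    fix i assume "i \<in> {..<DIM('e)}"
    then have i: "i < DIM('e)" by simp
    show "ext_at \<Omega> p (?E i p) (J p (?E i p)) w = ext_deriv2 A \<Omega> (?E i) (\<lambda>q. J q (?E i q)) ?W p"
      using ext_deriv2_eq_ext_at[OF smooth_bilinear_\<Omega> alternating_\<Omega> U E[OF i] smooth_vf_J[OF U(1) E[OF i]] W]
      by (simp add: exists_local_ext(1))
  qed
  also have "\<dots> = 2 * (\<Sum>i<DIM('e). cov2 A D \<Omega> (?E i) (?E i) (\<lambda>q. J q (?W q)) p)"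
    by (rule sum_ext_deriv2_frame[OF U E on W])
  also have "(\<Sum>i<DIM('e). cov2 A D \<Omega> (?E i) (?E i) (\<lambda>q. J q (?W q)) p) =
      (\<Sum>i<DIM('e). cov2 A D \<Omega> (?E i) (?E i) ?Z p)"
    by (rule sum.cong[OF refl], rule cov2_tensorial[OF U _ _ smooth_vf_J[OF U(1) W] Z])
      (auto simp: E exists_local_ext(1))
  also have "\<dots> = - codiff2 A g D \<Omega> p (J p w)" by (simp add: codiff2_def)
  finally show ?thesis using that[OF on[OF U(2)]] by simp
qed

lemma lee_form_unique:
  assumes eq: "\<And>u v w. ext_at \<Omega> p u v w = - 2 * wedge12 \<theta> \<Omega> p u v w"
    and dim: "DIM('e) = 2 * n" "DIM('e) \<ge> 4"
  shows "ah_lee_form A J g D n p w = \<theta> p w"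
proof -
  obtain e where e: "orthonormal p e (DIM('e))"
    and sum: "(\<Sum>i<DIM('e). ext_at \<Omega> p (e i) (J p (e i)) w) = - 2 * codiff2 A g D \<Omega> p (J p w)"
    by (rule contraction_ext_at)
  have "- 2 * codiff2 A g D \<Omega> p (J p w) = - 2 * (2 - real (DIM('e))) * \<theta> p w"
    using sum contraction_wedge[where p = p and e = e and \<theta> = \<theta> and w = w, OF e lee_solution_linear[OF eq]]
    unfolding eq sum_distrib_left[symmetric] by (simp add: left_diff_distrib)
  then have "codiff2 A g D \<Omega> p (J p w) = - 2 * (real n - 1) * \<theta> p w"
    using dim(1) by (simp add: algebra_simps)
  moreover have "- (1 / (2 * k)) * (- 2 * k * x) = x" if "k \<noteq> 0" for k x :: real
    using that by simp
  moreover have "real n - 1 \<noteq> 0" using dim by auto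
  ultimately show ?thesis unfolding ah_lee_form_def by metis
qed

text \<open>Pointwise solutions of the Lee equation suffice: they coincide with the Lee form, and this
  is smooth as a contraction of \<open>d\<Omega>\<close> over a smooth frame.\<close>

lemma W2_W4_pointwise:
  assumes ex: "\<And>p. \<exists>\<theta>. \<forall>u v w. ext_at \<Omega> p u v w = - 2 * wedge12 (\<lambda>_. \<theta>) \<Omega> p u v w"
    and dim: "DIM('e) = 2 * n" "DIM('e) \<ge> 4"
  shows "gray_hervella_W2_W4 A J g"
proof -
  let ?\<beta> = "ah_lee_form A J g D n"
  have eq: "ext_at \<Omega> p u v w = - 2 * wedge12 ?\<beta> \<Omega> p u v w" for p u v w
  proof -
    obtain \<theta> where \<theta>: "\<And>u v w. ext_at \<Omega> p u v w = - 2 * wedge12 (\<lambda>_. \<theta>) \<Omega> p u v w" using ex by blast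
    have "?\<beta> p w = \<theta> w" for w using lee_form_unique[OF \<theta> dim] .
    then show ?thesis using \<theta> by (simp add: wedge12_def)
  qed
  have lin: "linear (?\<beta> p)" for p using lee_solution_linear[OF eq] .
  have "msmooth_on A U (\<lambda>p. ?\<beta> p (X p))" if U: "open U" and X: "smooth_vf A U X" for U X
  proof (rule msmooth_on_local[OF U])
    fix p assume p: "p \<in> U"
    obtain E V where V: "open V" "p \<in> V" and E1: "\<And>i. i < DIM('e) \<Longrightarrow> smooth_vf A V (E i)"
      and on1: "\<And>q. q \<in> V \<Longrightarrow> orthonormal q (\<lambda>i. E i q) (DIM('e))"
      using local_orthonormal_frame_exists[of p]
      unfolding local_orthonormal_frame_def orthonormal_def by blast
    have UV: "open (U \<inter> V)" using U V by blast
    have X': "smooth_vf A (U \<inter> V) X" by (rule smooth_vf_subset[OF X]) simp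
    have E: "smooth_vf A (U \<inter> V) (E i)" if "i < DIM('e)" for i
      by (rule smooth_vf_subset[OF E1[OF that]]) simp
    note \<Omega>' = smooth_bilinear_\<Omega>[unfolded smooth_bilinear_def, THEN conjunct2, rule_format, OF UV]
    define h where "h q = (\<Sum>i<DIM('e). 2 * cov2 A D \<Omega> (E i) (E i) (\<lambda>q. J q (X q)) q)" for q
    have "?\<beta> q (X q) = (1 / (4 * (real n - 1))) * h q" if q: "q \<in> U \<inter> V" for q
    proof -
      have on: "orthonormal q (\<lambda>i. E i q) (DIM('e))" using on1 q by blast
      have "h q = (\<Sum>i<DIM('e). ext_deriv2 A \<Omega> (E i) (\<lambda>q. J q (E i q)) X q)"
        using sum_ext_deriv2_frame[OF UV q E _ X'] on1 by (simp add: h_def sum_distrib_left)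
      also have "\<dots> = (\<Sum>i<DIM('e). - 2 * wedge12 ?\<beta> \<Omega> q (E i q) (J q (E i q)) (X q))"
        using ext_deriv2_eq_ext_at[OF smooth_bilinear_\<Omega> alternating_\<Omega> UV q E smooth_vf_J[OF UV E] X'] eq
        by simp
      also have "\<dots> = - 2 * ((2 - real (DIM('e))) * ?\<beta> q (X q))"
        unfolding sum_distrib_left[symmetric] contraction_wedge[where \<theta> = ?\<beta> and w = "X q", OF on lin] ..
      finally have "h q = 4 * (real n - 1) * ?\<beta> q (X q)" using dim(1) by (simp add: algebra_simps)
      moreover have "real n - 1 \<noteq> 0" using dim by auto
      ultimately show ?thesis by simp
    qed
    moreover have "msmooth_on A (U \<inter> V) (\<lambda>q. (1 / (4 * (real n - 1))) * h q)"
      unfolding h_def cov2_def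
      by (intro msmooth_on_cmult msmooth_on_sum UV msmooth_on_diff msmooth_on_mderiv \<Omega>' D_smooth[OF UV]
          smooth_vf_J[OF UV] E X') auto
    ultimately have "msmooth_on A (U \<inter> V) (\<lambda>p. ?\<beta> p (X p))"
      using msmooth_on_cong[OF UV] by (metis (no_types, lifting))
    then show "\<exists>V. open V \<and> p \<in> V \<and> msmooth_on A (U \<inter> V) (\<lambda>p. ?\<beta> p (X p))" using V by blast
  qed
  then have "one_form A ?\<beta>" unfolding one_form_def using lin by blast
  moreover have "lee_equation A ?\<beta> \<Omega>"
    unfolding lee_equation_def using ext_deriv2_eq_ext_at[OF smooth_bilinear_\<Omega> alternating_\<Omega>] eq by simp
  ultimately show ?thesis unfolding gray_hervella_W2_W4_def using almost_hermitian by blast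
qed

end

section \<open>Contact-complex Riemannian submersions\<close>

locale contact_complex =
  fixes A :: "('a::{t2_space,second_countable_topology}, 'e::euclidean_space) atlas"
    and \<phi> :: "('a, 'e) endo" and \<xi> :: "('a, 'e) vfield" and \<eta> :: "('a, 'e) form1"
    and g :: "('a, 'e) form2"
    and B :: "('b::{t2_space,second_countable_topology}, 'f::euclidean_space) atlas"
    and J :: "('b, 'f) endo" and h :: "('b, 'f) form2" and \<pi> :: "'a \<Rightarrow> 'b"
    and D' :: "('b, 'f) conn"
  assumes submersion: "contact_complex_submersion A \<phi> \<xi> \<eta> g B J h \<pi>"
    and levi_civita: "levi_civita B h D'"

sublocale contact_complex \<subseteq> M: riemannian_manifold A g
  using submersion
  by unfold_locales (auto simp: contact_complex_submersion_def almost_contact_metric_def)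

sublocale contact_complex \<subseteq> N: hermitian_manifold B J h D'
  using submersion levi_civita by unfold_locales (auto simp: contact_complex_submersion_def)

sublocale contact_complex \<subseteq> manifold_map A B \<pi>
  using submersion
  by unfold_locales (auto simp: contact_complex_submersion_def riemannian_submersion_def)

context contact_complex
begin

abbreviation "hor \<equiv> horizontal A g B \<pi>"
abbreviation "\<Phi> \<equiv> fundamental_form g \<phi>"

lemma acm: "almost_contact_metric A \<phi> \<xi> \<eta> g"
  using submersion unfolding contact_complex_submersion_def by blast

lemma \<phi>_\<phi>: "\<phi> p (\<phi> p v) = - v + \<eta> p v *\<^sub>R \<xi> p"
  and \<eta>_\<xi>: "\<eta> p (\<xi> p) = 1"
  and g_\<phi>_\<phi>: "g p (\<phi> p u) (\<phi> p v) = g p u v - \<eta> p u * \<eta> p v"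
  using acm unfolding almost_contact_metric_def by blast+

lemma linear_\<phi>: "linear (\<phi> p)"
  using acm unfolding almost_contact_metric_def endo_field_def by blast

lemma linear_\<eta>: "linear (\<eta> p)"
  using acm unfolding almost_contact_metric_def one_form_def by blast

lemma smooth_vf_\<phi>: "open U \<Longrightarrow> smooth_vf A U X \<Longrightarrow> smooth_vf A U (\<lambda>p. \<phi> p (X p))"
  using acm unfolding almost_contact_metric_def endo_field_def by blast

text \<open>As \<open>\<phi>\<^sup>2 \<xi> = 0\<close>, the formula for \<open>\<phi>\<^sup>2\<close> at \<open>\<phi> \<xi>\<close> makes \<open>\<phi> \<xi>\<close> a multiple of \<open>\<xi>\<close>; applying \<open>\<phi>\<close>
  once more shows that the factor or \<open>\<phi> \<xi>\<close> is \<open>0\<close>.\<close>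

lemma \<phi>_\<xi>: "\<phi> p (\<xi> p) = 0"
proof -
  have \<xi>0: "\<xi> p \<noteq> 0" using \<eta>_\<xi>[of p] linear_0[OF linear_\<eta>] by auto
  have 1: "\<phi> p (\<phi> p (\<xi> p)) = 0" by (simp add: \<phi>_\<phi> \<eta>_\<xi>)
  then have "\<phi> p (\<phi> p (\<phi> p (\<xi> p))) = 0" by (simp add: linear_0[OF linear_\<phi>])
  then have 2: "\<phi> p (\<xi> p) = \<eta> p (\<phi> p (\<xi> p)) *\<^sub>R \<xi> p"
    using \<phi>_\<phi>[of p "\<phi> p (\<xi> p)"] by (metis add.right_neutral add_minus_cancel)
  have "0 = \<eta> p (\<phi> p (\<xi> p)) *\<^sub>R \<phi> p (\<xi> p)"
    using 1 arg_cong[OF 2, of "\<phi> p"] by (simp add: linear_cmul[OF linear_\<phi>])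
  then show ?thesis using 2 by auto
qed

text \<open>The formula for \<open>\<phi>\<^sup>2\<close> gives \<open>\<phi>\<^sup>3 = -\<phi> + (\<eta> \<circ> \<phi>) \<xi>\<close> or \<open>\<phi>\<^sup>3 = -\<phi>\<close>, depending on whether it is
  applied to \<open>\<phi> v\<close> or under \<open>\<phi>\<close>.\<close>

lemma \<eta>_\<phi>: "\<eta> p (\<phi> p v) = 0"
proof -
  have "\<phi> p (\<phi> p (\<phi> p v)) = \<phi> p (- v + \<eta> p v *\<^sub>R \<xi> p)" by (simp only: \<phi>_\<phi>[of p v])
  also have "\<dots> = - \<phi> p v"
    by (simp add: linear_diff[OF linear_\<phi>] linear_cmul[OF linear_\<phi>] \<phi>_\<xi>
        add.commute[of "- v"])
  finally have "\<eta> p (\<phi> p v) *\<^sub>R \<xi> p = 0" using \<phi>_\<phi>[of p "\<phi> p v"] by simp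
  moreover have "\<xi> p \<noteq> 0" using \<eta>_\<xi>[of p] linear_0[OF linear_\<eta>] by auto
  ultimately show ?thesis by simp
qed

lemma \<eta>_eq: "\<eta> p v = g p v (\<xi> p)"
  using g_\<phi>_\<phi>[of p v "\<xi> p"] by (simp add: \<phi>_\<xi> \<eta>_\<xi> M.g_simps)

lemma g_\<phi>_left: "g p (\<phi> p u) v = - g p u (\<phi> p v)"
proof -
  have "g p u (\<phi> p v) = g p (\<phi> p u) (\<phi> p (\<phi> p v))" by (simp add: g_\<phi>_\<phi> \<eta>_\<phi>)
  also have "\<dots> = - g p (\<phi> p u) v"
    using \<eta>_eq[of p "\<phi> p u"] by (simp add: \<phi>_\<phi> \<eta>_\<phi> M.g_simps)
  finally show ?thesis by simp
qed

lemma smooth_bilinear_\<Phi>: "smooth_bilinear A \<Phi>"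
  unfolding smooth_bilinear_def fundamental_form_def bilinear_def
  using linear_compose[OF linear_\<phi> M.g_linear(1)] M.g_linear(2) M.msmooth_on_g smooth_vf_\<phi>
  by (simp add: o_def)

lemma T_\<phi>: "T p (\<phi> p v) = J (\<pi> p) (T p v)"
  using submersion unfolding contact_complex_submersion_def by simp

lemma surj_\<pi>: "surj \<pi>" and surj_T: "surj (T p)"
  and isometry: "hor p u \<Longrightarrow> hor p v \<Longrightarrow> h (\<pi> p) (T p u) (T p v) = g p u v"
  using submersion unfolding contact_complex_submersion_def riemannian_submersion_def by blast+

lemma T_\<phi>_vertical: "T p k = 0 \<Longrightarrow> T p (\<phi> p k) = 0"
  by (simp add: T_\<phi> linear_0[OF N.linear_J])

lemma horizontal_vertical: "hor p u \<Longrightarrow> T p k = 0 \<Longrightarrow> g p u k = 0"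
  unfolding horizontal_def by blast

lemma horizontal_\<phi>: "hor p u \<Longrightarrow> hor p (\<phi> p u)"
  unfolding horizontal_def using T_\<phi>_vertical g_\<phi>_left by simp

lemma horizontal_part:
  obtains u where "hor p u" "T p u = T p v"
proof -
  have "bilinear (g p)" unfolding bilinear_def using M.g_linear by blast
  moreover have "subspace {k. T p k = 0}" by (rule linear_subspace_kernel[OF linear_T])
  ultimately obtain k where "T p k = 0" "\<And>w. T p w = 0 \<Longrightarrow> g p (v - k) w = 0"
    using orthogonal_decomposition[of "g p" "{k. T p k = 0}" v] M.g_commute M.g_pos by auto
  then show ?thesis using that[of "v - k"] linear_diff[OF linear_T] by (simp add: horizontal_def)
qed

text \<open>The form \<open>\<Phi>\<close> differs from the pullback of \<open>\<Omega>\<close> by its values on vertical parts. These are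
  bounded by the squared lengths of the vertical parts, which are expressed here by smooth functions
  without reference to the vertical projection.\<close>

lemma \<Phi>_minus_pullback:
  fixes p v w
  defines "s \<equiv> \<lambda>v. g p v v - h (\<pi> p) (T p v) (T p v)"
  shows "hor p v \<Longrightarrow> s v = 0"
    and "\<bar>\<Phi> p v w - N.\<Omega> (\<pi> p) (T p v) (T p w)\<bar> \<le> (s v + s w) / 2"
proof -
  show "hor p v \<Longrightarrow> s v = 0" unfolding s_def using isometry by simp
  have dec: "\<exists>u k. v = u + k \<and> hor p u \<and> T p k = 0 \<and> s v = g p k k" for v
  proof -
    obtain u where u: "hor p u" "T p u = T p v" by (rule horizontal_part)
    define k where "k = v - u"
    have k: "T p k = 0" "v = u + k" unfolding k_def using u linear_diff[OF linear_T] by auto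
    have "g p u k = 0" "g p k u = 0" using horizontal_vertical[OF u(1) k(1)] M.g_commute by metis+
    then have "g p v v = g p u u + g p k k" unfolding k(2) by (simp add: M.g_simps)
    moreover have "h (\<pi> p) (T p v) (T p v) = g p u u" using isometry[OF u(1) u(1)] u(2) by simp
    ultimately show ?thesis unfolding s_def using k u(1) by auto
  qed
  obtain u k where v: "v = u + k" "hor p u" "T p k = 0" "s v = g p k k" using dec by blast
  obtain u' k' where w: "w = u' + k'" "hor p u'" "T p k' = 0" "s w = g p k' k'" using dec by blast
  have Tv: "T p v = T p u" and Tw: "T p w = T p u'"
    using v w linear_add[OF linear_T] by auto
  have "N.\<Omega> (\<pi> p) (T p v) (T p w) = g p u (\<phi> p u')"
    unfolding Tv Tw fundamental_form_def T_\<phi>[symmetric] by (rule isometry[OF v(2) horizontal_\<phi>[OF w(2)]])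
  moreover have "\<Phi> p v w = g p u (\<phi> p u') + g p k (\<phi> p k')"
    using horizontal_vertical[OF v(2) T_\<phi>_vertical[OF w(3)]]
      horizontal_vertical[OF horizontal_\<phi>[OF w(2)] v(3)] M.g_commute[of p k]
    unfolding v(1) w(1) fundamental_form_def by (simp add: M.g_simps linear_add[OF linear_\<phi>])
  moreover have "\<bar>g p k (\<phi> p k')\<bar> \<le> (g p k k + g p k' k') / 2"
  proof -
    have "0 \<le> g p (k + \<phi> p k') (k + \<phi> p k')" "0 \<le> g p (k - \<phi> p k') (k - \<phi> p k')"
      by (rule M.g_nonneg)+
    moreover have "g p (\<phi> p k') (\<phi> p k') \<le> g p k' k'" by (simp add: g_\<phi>_\<phi>)
    ultimately show ?thesis
      using M.g_commute[of p k "\<phi> p k'"] by (simp add: M.g_simps abs_le_iff)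
  qed
  ultimately show "\<bar>\<Phi> p v w - N.\<Omega> (\<pi> p) (T p v) (T p w)\<bar> \<le> (s v + s w) / 2"
    using v(4) w(4) by simp
qed

end

text \<open>At the common zero \<open>x\<close>, the nonnegative functions \<open>s + r\<close> and \<open>s - r\<close> have a minimum.\<close>

lemma derivative_zero_of_bound:
  fixes r s :: "'e::real_normed_vector \<Rightarrow> real"
  assumes r: "(r has_derivative r') (at x)" and s: "(s has_derivative s') (at x)"
    and S: "open S" "x \<in> S" and bound: "\<And>y. y \<in> S \<Longrightarrow> \<bar>r y\<bar> \<le> s y" and "s x = 0"
  shows "r' u = 0"
proof -
  have ev: "eventually (\<lambda>y. y \<in> S) (at x)" using S eventually_at_topological by blast
  have 0: "r x = 0" using bound[OF S(2)] assms(6) by simp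
  have "(\<lambda>u. s' u + r' u) = (\<lambda>u. 0)"
    by (rule has_derivative_local_min[OF has_derivative_add[OF s r]], rule eventually_mono[OF ev])
      (use bound 0 assms(6) in \<open>auto simp: abs_le_iff dest: bound\<close>)
  moreover have "(\<lambda>u. s' u - r' u) = (\<lambda>u. 0)"
    by (rule has_derivative_local_min[OF has_derivative_diff[OF s r]], rule eventually_mono[OF ev])
      (use bound 0 assms(6) in \<open>auto simp: abs_le_iff dest: bound\<close>)
  ultimately have "s' u + r' u = 0" "s' u - r' u = 0" by (metis (mono_tags))+
  then show ?thesis by simp
qed

context contact_complex
begin

text \<open>On coordinate fields that are horizontal at \<open>p\<close>, the form \<open>\<Phi>\<close> differs from the pullback of
  \<open>\<Omega>\<close> by at most half the sum of the squared lengths of their vertical parts. These are nonnegative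
  and vanish at \<open>p\<close>, so \<open>\<Phi>\<close> and the pullback have the same derivative there.\<close>

lemma mderiv_\<Phi>_horizontal:
  fixes p
  assumes v: "hor p v" and w: "hor p w"
  defines "K \<equiv> coord_field A (chart_at A p)"
  shows "mderiv A (\<lambda>q. \<Phi> q (K v q) (K w q)) p u =
    N.\<Omega> (\<pi> p) (Hess p v u) (T p w) + N.\<Omega> (\<pi> p) (T p v) (Hess p w u) +
    N.form_deriv N.\<Omega> (\<pi> p) (T p u) (T p v) (T p w)"
proof -
  let ?c = "chart_at A p" and ?x = "snd (chart_at A p) p"
  note c = M.chart_at[of p]
  define P where "P F v w = (\<lambda>q. F (\<pi> q) (T q (K v q)) (T q (K w q)) :: real)" for F v w
  have h: "smooth_bilinear B h"
    unfolding smooth_bilinear_def bilinear_def using N.g_linear N.msmooth_on_g by blast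
  have gK: "smooth_bilinear A g"
    unfolding smooth_bilinear_def bilinear_def using M.g_linear M.msmooth_on_g by blast
  have diff: "\<exists>f'. ((\<lambda>q. F q (K v q) (K w q)) \<circ> chart_inv ?c has_derivative f') (at ?x)"
    if "smooth_bilinear A F" for F v w
    unfolding K_def
    using M.mderiv_chart(3)[OF M.open_dom[OF c(1)] c(2) M.msmooth_on_components_form[OF that c(1)] c] by blast
  have Pdiff: "\<exists>f'. (P F v w \<circ> chart_inv ?c has_derivative f') (at ?x)" if "smooth_bilinear B F" for F v w
    unfolding P_def K_def using has_derivative_pullback[OF that] by blast
  \<comment> \<open>The squared length of the vertical part of \<open>K v\<close>.\<close>
  define s where "s v = (\<lambda>q. g q (K v q) (K v q) - P h v v q)" for v
  have s: "\<exists>s'. (s v \<circ> chart_inv ?c has_derivative s') (at ?x)" for v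
    using diff[OF gK, of v v] Pdiff[OF h, of v v] has_derivative_diff unfolding s_def o_def by blast
  obtain sv sw where sv: "(s v \<circ> chart_inv ?c has_derivative sv) (at ?x)"
    and sw: "(s w \<circ> chart_inv ?c has_derivative sw) (at ?x)" using s by blast
  have \<Phi>': "((\<lambda>q. \<Phi> q (K v q) (K w q)) \<circ> chart_inv ?c has_derivative
      mderiv A (\<lambda>q. \<Phi> q (K v q) (K w q)) p) (at ?x)"
    unfolding K_def
    by (rule M.mderiv_chart(3)[OF M.open_dom[OF c(1)] c(2) M.msmooth_on_components_form[OF smooth_bilinear_\<Phi> c(1)] c])
  note P' = has_derivative_pullback[OF N.smooth_bilinear_\<Omega>, of p v w, folded K_def]
  have Kp: "K v p = v" for v unfolding K_def by simp
  have x: "chart_inv ?c ?x = p" using M.chart_inv_chart[OF c] .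
  have r: "((\<lambda>y. ((\<lambda>q. \<Phi> q (K v q) (K w q)) \<circ> chart_inv ?c) y - (P N.\<Omega> v w \<circ> chart_inv ?c) y) has_derivative
    (\<lambda>u. mderiv A (\<lambda>q. \<Phi> q (K v q) (K w q)) p u -
      (N.\<Omega> (\<pi> p) (Hess p v u) (T p w) + N.\<Omega> (\<pi> p) (T p v) (Hess p w u) +
       N.form_deriv N.\<Omega> (\<pi> p) (T p u) (T p v) (T p w)))) (at ?x)"
    unfolding P_def by (rule has_derivative_diff[OF \<Phi>' P'])
  have s2: "((\<lambda>y. ((s v \<circ> chart_inv ?c) y + (s w \<circ> chart_inv ?c) y) / 2) has_derivative
      (\<lambda>u. (sv u + sw u) / 2)) (at ?x)"
    using has_derivative_scaleR_right[OF has_derivative_add[OF sv sw], of "1/2"] by simp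
  have "mderiv A (\<lambda>q. \<Phi> q (K v q) (K w q)) p u -
      (N.\<Omega> (\<pi> p) (Hess p v u) (T p w) + N.\<Omega> (\<pi> p) (T p v) (Hess p w u) +
       N.form_deriv N.\<Omega> (\<pi> p) (T p u) (T p v) (T p w)) = 0"
  proof (rule derivative_zero_of_bound[OF r s2 open_UNIV UNIV_I])
    show "\<bar>((\<lambda>q. \<Phi> q (K v q) (K w q)) \<circ> chart_inv ?c) y - (P N.\<Omega> v w \<circ> chart_inv ?c) y\<bar>
        \<le> ((s v \<circ> chart_inv ?c) y + (s w \<circ> chart_inv ?c) y) / 2" for y
      using \<Phi>_minus_pullback(2) by (simp add: s_def P_def)
    show "((s v \<circ> chart_inv ?c) ?x + (s w \<circ> chart_inv ?c) ?x) / 2 = 0"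
      using \<Phi>_minus_pullback(1)[OF v] \<Phi>_minus_pullback(1)[OF w] by (simp add: s_def P_def x Kp)
  qed
  then show ?thesis by simp
qed

text \<open>In the alternating sum the second derivatives of \<open>\<pi>\<close> cancel, because they are symmetric and \<open>\<Omega>\<close> is
  alternating.\<close>

lemma ext_deriv2_\<Phi>_horizontal:
  fixes p
  assumes u: "hor p u" and v: "hor p v" and w: "hor p w"
  defines "K \<equiv> coord_field A (chart_at A p)"
  shows "ext_deriv2 A \<Phi> (K u) (K v) (K w) p = N.ext_at N.\<Omega> (\<pi> p) (T p u) (T p v) (T p w)"
proof -
  have "N.\<Omega> (\<pi> p) (T p v) (Hess p w u) = - N.\<Omega> (\<pi> p) (Hess p u w) (T p v)"
    "N.\<Omega> (\<pi> p) (T p u) (Hess p w v) = - N.\<Omega> (\<pi> p) (Hess p v w) (T p u)"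
    "N.\<Omega> (\<pi> p) (T p u) (Hess p v w) = - N.\<Omega> (\<pi> p) (Hess p v w) (T p u)"
    "N.\<Omega> (\<pi> p) (Hess p v u) (T p w) = N.\<Omega> (\<pi> p) (Hess p u v) (T p w)"
    using alternatingD[OF N.alternating_\<Omega>] Hess_commute by metis+
  then show ?thesis
    unfolding K_def M.ext_deriv2_coord_field[OF smooth_bilinear_\<Phi>] N.ext_at_def
      mderiv_\<Phi>_horizontal[OF v w] mderiv_\<Phi>_horizontal[OF u w] mderiv_\<Phi>_horizontal[OF u v]
    by simp
qed

definition lift :: "'a \<Rightarrow> 'f \<Rightarrow> 'e" where
  "lift p x = (SOME u. hor p u \<and> T p u = x)"

lemma lift: "hor p (lift p x)" "T p (lift p x) = x"
proof -
  obtain v where "T p v = x" using surj_T by (metis surjD)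
  then have "\<exists>u. hor p u \<and> T p u = x" using horizontal_part[of p v] by metis
  from someI_ex[OF this] show "hor p (lift p x)" "T p (lift p x) = x" unfolding lift_def by auto
qed

lemma lift_T:
  assumes "hor p u"
  shows "lift p (T p u) = u"
proof -
  let ?k = "lift p (T p u) - u"
  have "T p ?k = 0" using lift(2) linear_diff[OF linear_T] by simp
  then have "g p ?k ?k = 0"
    using horizontal_vertical[OF lift(1)] horizontal_vertical[OF assms]
    by (simp add: linear_diff[OF M.g_linear(2), of p "lift p (T p u)" u])
  then show ?thesis using M.g_eq_0_iff by simp
qed

text \<open>Each point \<open>p\<close> of a fibre provides a solution of the Lee equation of the base at \<open>\<pi> p\<close>. That
  these solutions agree along the fibre is a consequence of \<open>lee_form_unique\<close>.\<close>

lemma lee_equation_at_\<pi>: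
  assumes "lee_equation A \<omega> \<Phi>"
  shows "N.ext_at N.\<Omega> (\<pi> p) x y z = - 2 * wedge12 (\<lambda>_ x. \<omega> p (lift p x)) N.\<Omega> (\<pi> p) x y z"
proof -
  let ?K = "coord_field A (chart_at A p)"
  have "N.ext_at N.\<Omega> (\<pi> p) x y z = ext_deriv2 A \<Phi> (?K (lift p x)) (?K (lift p y)) (?K (lift p z)) p"
    using ext_deriv2_\<Phi>_horizontal[OF lift(1) lift(1) lift(1)] by (simp add: lift(2))
  also have "\<dots> = - 2 * wedge12 \<omega> \<Phi> p (lift p x) (lift p y) (lift p z)"
    using assms[unfolded lee_equation_def, rule_format, OF M.open_dom[OF M.chart_at(1)]
        M.smooth_vf_coord_field[OF M.chart_at(1)] M.smooth_vf_coord_field[OF M.chart_at(1)]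
        M.smooth_vf_coord_field[OF M.chart_at(1)] M.chart_at(2)] by simp
  also have "\<Phi> p (lift p x) (lift p y) = N.\<Omega> (\<pi> p) x y" for x y
    using \<Phi>_minus_pullback(2)[of p "lift p x" "lift p y"] \<Phi>_minus_pullback(1)[OF lift(1)]
    by (simp add: lift(2))
  then have "wedge12 \<omega> \<Phi> p (lift p x) (lift p y) (lift p z) =
      wedge12 (\<lambda>_ x. \<omega> p (lift p x)) N.\<Omega> (\<pi> p) x y z"
    by (simp add: wedge12_def)
  finally show ?thesis .
qed

end

theorem proposition2p3:
  fixes A :: "('a::{t2_space,second_countable_topology}, 'e::euclidean_space) atlas"
    and \<phi> :: "('a, 'e) endo" and \<xi> :: "('a, 'e) vfield" and \<eta> :: "('a, 'e) form1"
    and g :: "('a, 'e) form2" and D :: "('a, 'e) conn"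
    and A' :: "('b::{t2_space,second_countable_topology}, 'f::euclidean_space) atlas"
    and J :: "('b, 'f) endo" and g' :: "('b, 'f) form2" and D' :: "('b, 'f) conn"
    and \<pi> :: "'a \<Rightarrow> 'b" and \<omega> :: "('a, 'e) form1" and \<beta> :: "('b, 'f) form1"
    and m n :: nat
  assumes "contact_complex_submersion A \<phi> \<xi> \<eta> g A' J g' \<pi>"
    and "DIM('e) = 2 * m + 1" and "DIM('e) \<ge> 5"
    and "DIM('f) = 2 * n" and "DIM('f) \<ge> 4"
    and "levi_civita A g D" and "levi_civita A' g' D'"
    and "\<omega> = acm_lee_form A \<phi> \<xi> \<eta> g D m"
    and "\<beta> = ah_lee_form A' J g' D' n"
    and "lee_equation A \<omega> (fundamental_form g \<phi>)"
  shows "(\<forall>X X'. basic_field A g A' \<pi> X X' \<longrightarrow> (\<forall>p. \<beta> (\<pi> p) (X' (\<pi> p)) = \<omega> p (X p))) \<and>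
         gray_hervella_W2_W4 A' J g'"
proof -
  interpret contact_complex A \<phi> \<xi> \<eta> g A' J g' \<pi> D'
    by unfold_locales (fact assms)+
  note at_\<pi> = lee_equation_at_\<pi>[OF assms(10)]
  have "\<beta> (\<pi> p) (X' (\<pi> p)) = \<omega> p (X p)" if "basic_field A g A' \<pi> X X'" for X X' p
  proof -
    have X: "hor p (X p)" "T p (X p) = X' (\<pi> p)" using that by (auto simp: basic_field_def)
    have "\<beta> (\<pi> p) (X' (\<pi> p)) = \<omega> p (lift p (X' (\<pi> p)))"
      unfolding assms(9) by (rule N.lee_form_unique[OF at_\<pi> assms(4,5)])
    also have "\<dots> = \<omega> p (X p)" using lift_T[OF X(1)] X(2) by simp
    finally show ?thesis .
  qed
  moreover have "gray_hervella_W2_W4 A' J g'"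
  proof (rule N.W2_W4_pointwise[OF _ assms(4,5)])
    fix x
    obtain p where "x = \<pi> p" using surj_\<pi> by (metis surjD)
    then show "\<exists>\<theta>. \<forall>u v w. N.ext_at N.\<Omega> x u v w = - 2 * wedge12 (\<lambda>_. \<theta>) N.\<Omega> x u v w"
      using at_\<pi> by blast
  qed
  ultimately show ?thesis by blast
qed

end
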